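(* Let $\alpha\in(1,2)$, let $\mathcal{L}\in\mathbb{H}_\alpha$ have mean $\int_0^\infty x\,\mathcal{L}(dx)=1$, let $K$ be the $n\times n$ random reversible Markov matrix built from i.i.d. weights of law $\mathcal{L}$, and set $\kappa_n=n a_n^{-1}$. Let $\mu_\alpha$ be the limiting spectral distribution of symmetric i.i.d. heavy-tailed matrices with index $\alpha$. Then almost surely $$\mu_{\kappa_n K}:=\frac1n\sum_{k=1}^n\delta_{\lambda_k(\kappa_nK)}\ \longrightarrow\ \mu_\alpha\qquad\text{weakly as } n\to\infty .$$
   Context: For $\alpha>0$, $\mathbb{H}_\alpha$ is the class of probability laws $\mathcal{L}$ supported in $[0,\infty)$ whose tail is regularly varying of index $\alpha$: $G(t):=\mathcal{L}((t,\infty))=L(t)t^{-\alpha}$ for all $t>0$, with $L$ slowly varying at $\infty$ (i.e. $L(xt)/L(t)\to1$ as $t\to\infty$ for every $x>0$). Set $a_n=\inf\{a>0: nG(a)\le 1\}$. Let $(U_{i,j})_{1\le i\le j}$ be an infinite table of i.i.d. random variables of law $\mathcal{L}$, with $U_{j,i}=U_{i,j}$. For each $n$, $K=K^{(n)}$ is the $n\times n$ matrix $K_{i,j}=U_{i,j}/\rho_i$ with $\rho_i=\sum_{j=1}^nU_{i,j}$ (and $K_{i,j}=\delta_{i,j}$ for all $j$ if $\rho_i=0$). $K$ is self-adjoint in $L^2(\rho)$, so its eigenvalues $\lambda_1\ge\dots\ge\lambda_n$ are real. For an $n\times n$ matrix $M$ with real spectrum, $\mu_M=\frac1n\sum_k\delta_{\lambda_k(M)}$.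 Weak convergence is with respect to bounded continuous functions. Definition of $\mu_\alpha$, $\alpha\in(0,2)$: let $X=(X_{i,j})_{1\le i,j\le n}$ be a real symmetric random matrix taken from an infinite table with $(X_{i,j})_{i\le j}$ i.i.d., such that the law of $|X_{i,j}|$ is in $\mathbb{H}_\alpha$ and $\lim_{t\to\infty}\mathbb{P}(X_{i,j}>t)/\mathbb{P}(|X_{i,j}|>t)$ exists. Then (known result) almost surely $\mu_{a_n^{-1}X}$ converges weakly to a symmetric probability measure $\mu_\alpha$ on $\mathbb{R}$ depending only on $\alpha$, where in this definition $a_n=\inf\{a>0: n\,\mathbb{P}(|X_{1,1}|>a)\le 1\}$. *)

theory Defs
  imports
    "HOL-Probability.Probability"
    "Jordan_Normal_Form.Char_Poly"
begin

section \<open>Heavy-tailed laws\<close>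

definition slowly_varying :: "(real \<Rightarrow> real) \<Rightarrow> bool" where
  "slowly_varying l \<longleftrightarrow> (\<forall>x>0. ((\<lambda>t. l (x * t) / l t) \<longlongrightarrow> 1) at_top)"

definition tail :: "real measure \<Rightarrow> real \<Rightarrow> real" where
  "tail L t = measure L {t<..}"

definition heavy_tailed :: "real \<Rightarrow> real measure set" where
  "heavy_tailed \<alpha> = {L. prob_space L \<and> sets L = sets borel \<and> measure L {..<0} = 0 \<and>
     (\<exists>l. slowly_varying l \<and> (\<forall>t>0. tail L t = l t * t powr (- \<alpha>)))}"

text \<open>
  The sequence $a_n$.  The infimum is over a nonempty set bounded below for \<open>n \<ge> 1\<close>;
  the value at \<open>n = 0\<close> is irrelevant for the limits below.
\<close>

definition quantile_scale :: "real measure \<Rightarrow> nat \<Rightarrow> real" where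
  "quantile_scale L n = Inf {a. a > 0 \<and> real n * tail L a \<le> 1}"

definition kappa :: "real measure \<Rightarrow> nat \<Rightarrow> real" where
  "kappa L n = real n * inverse (quantile_scale L n)"


section \<open>Empirical spectral measures and weak convergence\<close>

text \<open>
  The real eigenvalues in non-increasing order, repeated according to algebraic multiplicity.
  If all complex eigenvalues of the \<open>n \<times> n\<close> matrix \<open>A\<close> are real, this list has length \<open>n\<close>;
  only such matrices are of interest here.
\<close>

definition eigenvalue_list :: "real mat \<Rightarrow> real list" where
  "eigenvalue_list A = rev (sorted_list_of_multiset (proots (char_poly A)))"

text \<open>
  $\mu_A = \frac1n \sum_k \delta_{\lambda_k(A)}$, as the push-forward of the uniform distribution
  on the indices \<open>k < n\<close> under \<open>k \<mapsto> \<lambda>\<^sub>k(A)\<close>.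
\<close>

definition empirical_spectral_measure :: "real mat \<Rightarrow> real measure" where
  "empirical_spectral_measure A =
     distr (uniform_count_measure {..<dim_row A}) borel (\<lambda>k. eigenvalue_list A ! k)"

definition converges_weakly :: "(nat \<Rightarrow> real measure) \<Rightarrow> real measure \<Rightarrow> bool" where
  "converges_weakly \<nu> \<mu> \<longleftrightarrow>
     (\<forall>f :: real \<Rightarrow> real. continuous_on UNIV f \<longrightarrow> bounded (range f) \<longrightarrow>
        (\<lambda>n. integral\<^sup>L (\<nu> n) f) \<longlonglongrightarrow> integral\<^sup>L \<mu> f)"


section \<open>The limiting spectral distribution of symmetric i.i.d. matrices\<close>

abbreviation upper_indices :: "(nat \<times> nat) set" where
  "upper_indices \<equiv> {(i, j). i \<le> j}"

text \<open>
  The symmetric \<open>n \<times> n\<close> matrix cut out of a table of entries indexed by \<open>i \<le> j\<close>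
  (all indices start at 0).
\<close>

definition symmetric_matrix :: "(nat \<times> nat \<Rightarrow> real) \<Rightarrow> nat \<Rightarrow> real mat" where
  "symmetric_matrix x n = mat n n (\<lambda>(i, j). x (min i j, max i j))"

text \<open>
  The property defining $\mu_\alpha$: \<open>\<mu>\<close> is a symmetric probability measure on the real line, and
  for every admissible entry law \<open>\<nu>\<close> the rescaled matrices have spectral measures converging almost
  surely to \<open>\<mu>\<close>.  The infinite i.i.d. table of law \<open>\<nu>\<close> is realized on its canonical space, the
  product measure: the almost sure statement depends only on the joint law of the table, and
  this avoids quantifying over the type of the sample space.  Weak limits being unique,
  the property determines \<open>\<mu>\<close>.
\<close>

definition limiting_spectral_distribution :: "real \<Rightarrow> real measure \<Rightarrow> bool" where
  "limiting_spectral_distribution \<alpha> \<mu> \<longleftrightarrow>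
     prob_space \<mu> \<and> sets \<mu> = sets borel \<and> distr \<mu> borel uminus = \<mu> \<and>
     (\<forall>\<nu>. prob_space \<nu> \<and> sets \<nu> = sets borel \<and>
          distr \<nu> borel abs \<in> heavy_tailed \<alpha> \<and>
          (\<exists>\<theta>. ((\<lambda>t. measure \<nu> {t<..} / measure \<nu> {x. \<bar>x\<bar> > t}) \<longlongrightarrow> \<theta>) at_top) \<longrightarrow>
        (AE x in PiM upper_indices (\<lambda>_. \<nu>).
           converges_weakly
             (\<lambda>n. empirical_spectral_measure
                (inverse (quantile_scale (distr \<nu> borel abs) n) \<cdot>\<^sub>m symmetric_matrix x n)) \<mu>))"


section \<open>The random reversible Markov matrix\<close>

definition iid_symmetric_table ::
  "'a measure \<Rightarrow> real measure \<Rightarrow> (nat \<Rightarrow> nat \<Rightarrow> 'a \<Rightarrow> real) \<Rightarrow> bool" where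
  "iid_symmetric_table M L U \<longleftrightarrow>
     prob_space.indep_vars M (\<lambda>_. borel) (\<lambda>(i, j). U i j) upper_indices \<and>
     (\<forall>i j. i \<le> j \<longrightarrow> distr M borel (U i j) = L) \<and>
     (\<forall>i j. U j i = U i j)"

definition row_sum :: "(nat \<Rightarrow> nat \<Rightarrow> real) \<Rightarrow> nat \<Rightarrow> nat \<Rightarrow> real" where
  "row_sum u n i = (\<Sum>j<n. u i j)"

definition markov_matrix :: "(nat \<Rightarrow> nat \<Rightarrow> real) \<Rightarrow> nat \<Rightarrow> real mat" where
  "markov_matrix u n = mat n n (\<lambda>(i, j).
     if row_sum u n i = 0 then (if i = j then 1 else 0) else u i j / row_sum u n i)"

end

theory Submission
  imports Defs
begin

text \<open>
  The law of the weights is itself admissible in the definition of \<open>\<mu>\<close>, so the symmetric matrices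
  \<open>a\<^sub>n\<^sup>-\<^sup>1 U\<close> have the desired limit almost surely.  It remains to compare their spectrum with that of
  \<open>\<kappa>\<^sub>n K = D\<^sup>-\<^sup>1 (a\<^sub>n\<^sup>-\<^sup>1 U)\<close>, where \<open>D\<close> is the diagonal matrix of the averages \<open>\<rho>\<^sub>i / n\<close>.  These averages are
  not uniformly close to 1, since a single weight can be of order larger than \<open>n\<close>, but all except
  \<open>o(n)\<close> of them are: the row averages of weights truncated at a fixed level concentrate uniformly
  by Hoeffding's inequality, and the remainder has a small total sum by a law of large numbers along
  dyadic \<open>n\<close>.  Discarding the \<open>b\<close> exceptional rows changes every eigenvalue count by at most \<open>b\<close>, as
  a dimension count for the quadratic forms shows, and on the other rows the forms \<open>D\<close> and
  \<open>I\<close> are close.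
\<close>

section \<open>Diagonalization of a symmetric form relative to a weighted inner product\<close>

text \<open>Gaussian elimination, one equation at a time: an equation with a nonzero coefficient at
  \<open>y\<close> is solved for \<open>y\<close> and substituted into the others. Arbitrary index
  types are kept so that a later dimension count can index by disjoint sums.\<close>

lemma homogeneous_system_nontrivial:
  fixes a :: "'e \<Rightarrow> 'x \<Rightarrow> 'b::field"
  assumes "finite E" "finite X" "card E < card X"
  shows "\<exists>c. (\<exists>x\<in>X. c x \<noteq> 0) \<and> (\<forall>e\<in>E. (\<Sum>x\<in>X. a e x * c x) = 0)"
  using assms
proof (induction E arbitrary: X a rule: finite_induct)
  case empty
  then have "X \<noteq> {}" by auto
  then show ?case by (intro exI[of _ "\<lambda>_. 1"]) auto
next
  case (insert e E)
  show ?case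
  proof (cases "\<forall>x\<in>X. a e x = 0")
    case True
    obtain c where "\<exists>x\<in>X. c x \<noteq> 0" "\<forall>f\<in>E. (\<Sum>x\<in>X. a f x * c x) = 0"
      using insert.IH[of X a] insert.prems insert.hyps by auto
    with True show ?thesis by (intro exI[of _ c]) auto
  next
    case False
    then obtain y where y: "y \<in> X" "a e y \<noteq> 0" by auto
    define X' where "X' = X - {y}"
    have X: "X = insert y X'" "y \<notin> X'" "finite X'" using y insert.prems by (auto simp: X'_def)
    have "card E < card X'" using insert.prems insert.hyps X by auto
    then obtain c where c: "\<exists>x\<in>X'. c x \<noteq> 0"
        "\<And>f. f \<in> E \<Longrightarrow> (\<Sum>x\<in>X'. (a f x - a f y * a e x / a e y) * c x) = 0"
      using insert.IH[of X' "\<lambda>f x. a f x - a f y * a e x / a e y"] X by blast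
    define S where "S = (\<Sum>x\<in>X'. a e x * c x)"
    \<comment> \<open>The value at \<open>y\<close> is forced by equation \<open>e\<close>;
      substituting it turns every other equation into the reduced one solved by
      \<open>c\<close>.\<close>
    define c' where "c' = c(y := - S / a e y)"
    have sum: "(\<Sum>x\<in>X. a f x * c' x) = (\<Sum>x\<in>X'. a f x * c x) - a f y * S / a e y" for f
    proof -
      have "(\<Sum>x\<in>X. a f x * c' x) = a f y * c' y + (\<Sum>x\<in>X'. a f x * c' x)"
        using X by simp
      also have "(\<Sum>x\<in>X'. a f x * c' x) = (\<Sum>x\<in>X'. a f x * c x)"
        using X by (intro sum.cong) (auto simp: c'_def)
      finally show ?thesis by (simp add: c'_def)
    qed
    have "(\<Sum>x\<in>X. a f x * c' x) = 0" if "f \<in> insert e E" for f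
    proof (cases "f = e")
      case True
      then show ?thesis using y by (simp add: sum S_def)
    next
      case False
      then have "0 = (\<Sum>x\<in>X'. (a f x - a f y * a e x / a e y) * c x)" using that c by auto
      also have "\<dots> = (\<Sum>x\<in>X'. a f x * c x) - a f y * S / a e y"
        by (simp add: left_diff_distrib right_diff_distrib sum_subtractf S_def sum_distrib_left sum_divide_distrib mult_ac)
      finally show ?thesis by (simp add: sum)
    qed
    moreover have "\<exists>x\<in>X. c' x \<noteq> 0" using c(1) X by (auto simp: c'_def)
    ultimately show ?thesis by (intro exI[of _ c']) auto
  qed
qed

section \<open>Quadratic forms and eigenvectors relative to a diagonal weight\<close>

definition quad_form :: "nat \<Rightarrow> (nat \<Rightarrow> nat \<Rightarrow> real) \<Rightarrow> (nat \<Rightarrow> real) \<Rightarrow> (nat \<Rightarrow> real) \<Rightarrow> real" where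
  "quad_form n w x y = (\<Sum>i<n. x i * (\<Sum>j<n. w i j * y j))"

definition weighted_prod :: "nat \<Rightarrow> (nat \<Rightarrow> real) \<Rightarrow> (nat \<Rightarrow> real) \<Rightarrow> (nat \<Rightarrow> real) \<Rightarrow> real" where
  "weighted_prod n d x y = (\<Sum>i<n. d i * x i * y i)"

definition symmetric_on :: "nat \<Rightarrow> (nat \<Rightarrow> nat \<Rightarrow> real) \<Rightarrow> bool" where
  "symmetric_on n w \<longleftrightarrow> (\<forall>i<n. \<forall>j<n. w i j = w j i)"

text \<open>The generalized eigenvalue problem W p = l D p with D = diag(\<open>d\<close>) and
  vectors orthonormal for D. For positive \<open>d\<close> and \<open>k = n\<close> the numbers
  \<open>l a\<close> are the eigenvalues of D^(-1) W; smaller \<open>k\<close> are the stages of an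
  inductive construction. Vectors are functions on \<open>nat\<close> read only below
  \<open>n\<close>.\<close>

definition eigenbasis ::
  "nat \<Rightarrow> (nat \<Rightarrow> real) \<Rightarrow> (nat \<Rightarrow> nat \<Rightarrow> real) \<Rightarrow> nat \<Rightarrow> (nat \<Rightarrow> nat \<Rightarrow> real) \<Rightarrow> (nat \<Rightarrow> real) \<Rightarrow> bool" where
  "eigenbasis n d w k p l \<longleftrightarrow>
     (\<forall>a<k. \<forall>b<k. weighted_prod n d (p a) (p b) = (if a = b then 1 else 0)) \<and>
     (\<forall>a<k. \<forall>i<n. (\<Sum>j<n. w i j * p a j) = l a * d i * p a i)"

lemma quad_form_commute:
  assumes "symmetric_on n w" shows "quad_form n w x y = quad_form n w y x"
proof -
  have "quad_form n w x y = (\<Sum>i<n. \<Sum>j<n. w i j * x i * y j)"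
    by (simp add: quad_form_def sum_distrib_left mult_ac)
  also have "\<dots> = (\<Sum>j<n. \<Sum>i<n. w i j * x i * y j)" by (rule sum.swap)
  also have "\<dots> = (\<Sum>j<n. \<Sum>i<n. w j i * x i * y j)"
    using assms by (intro sum.cong refl) (auto simp: symmetric_on_def)
  also have "\<dots> = quad_form n w y x"
    by (simp add: quad_form_def sum_distrib_left mult_ac)
  finally show ?thesis .
qed

lemma quad_form_sum_left:
  "quad_form n w (\<lambda>i. \<Sum>a\<in>A. c a * f a i) y = (\<Sum>a\<in>A. c a * quad_form n w (f a) y)"
proof -
  have "quad_form n w (\<lambda>i. \<Sum>a\<in>A. c a * f a i) y = (\<Sum>i<n. \<Sum>a\<in>A. c a * (f a i * (\<Sum>j<n. w i j * y j)))"
    by (simp add: quad_form_def sum_distrib_right mult.assoc)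
  then show ?thesis by (subst (asm) sum.swap) (simp add: quad_form_def sum_distrib_left)
qed

lemma weighted_prod_commute: "weighted_prod n d x y = weighted_prod n d y x"
  by (simp add: weighted_prod_def mult_ac)

lemma weighted_prod_sum_left:
  "weighted_prod n d (\<lambda>i. \<Sum>a\<in>A. c a * f a i) y = (\<Sum>a\<in>A. c a * weighted_prod n d (f a) y)"
  unfolding weighted_prod_def sum_distrib_left sum_distrib_right
  by (subst sum.swap) (simp add: mult_ac)

lemma weighted_prod_add_left:
  "weighted_prod n d (\<lambda>i. x i + t * h i) y = weighted_prod n d x y + t * weighted_prod n d h y"
  unfolding weighted_prod_def
  by (simp add: algebra_simps sum.distrib sum_distrib_left)

lemma weighted_prod_add_right:
  "weighted_prod n d y (\<lambda>i. x i + t * h i) = weighted_prod n d y x + t * weighted_prod n d y h"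
  by (metis weighted_prod_add_left weighted_prod_commute)

lemma quad_form_add_left:
  "quad_form n w (\<lambda>i. x i + t * h i) y = quad_form n w x y + t * quad_form n w h y"
  unfolding quad_form_def
  by (simp add: algebra_simps sum.distrib sum_distrib_left)

lemma quad_form_add_right:
  "quad_form n w y (\<lambda>i. x i + t * h i) = quad_form n w y x + t * quad_form n w y h"
  unfolding quad_form_def
  by (simp add: algebra_simps sum.distrib sum_distrib_left)

lemma weighted_prod_self_pos:
  assumes "\<And>i. i < n \<Longrightarrow> d i > 0" "i < n" "x i \<noteq> 0"
  shows "weighted_prod n d x x > 0"
proof -
  have "0 < d i * (x i)\<^sup>2" using assms by simp
  then show ?thesis
    unfolding weighted_prod_def mult.assoc power2_eq_square[symmetric]
    using assms by (intro sum_pos2[of _ i]) (auto simp: less_imp_le)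
qed

text \<open>This is the first-order condition at a maximum: near 0 the linear term dominates, so a
  nonzero slope would give positive values on one side.\<close>

lemma linear_coeff_zero_if_quadratic_nonpos:
  fixes b c :: real
  assumes "\<And>t. 2 * t * b + t\<^sup>2 * c \<le> 0"
  shows "b = 0"
proof (rule ccontr)
  assume "b \<noteq> 0"
  \<comment> \<open>With s > |c| the point t = b / s gives the value b^2 (2 s + c) / s^2 >
    0.\<close>
  define s where "s = \<bar>c\<bar> + 1"
  have s: "s > 0" "2 * s + c > 0" by (auto simp: s_def)
  have "2 * (b / s) * b + (b / s)\<^sup>2 * c = b\<^sup>2 * (2 * s + c) / s\<^sup>2"
    using s by (simp add: field_simps power2_eq_square)
  moreover have "b\<^sup>2 * (2 * s + c) / s\<^sup>2 > 0"
    using \<open>b \<noteq> 0\<close> s by (intro divide_pos_pos mult_pos_pos) auto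
  ultimately show False using assms[of "b / s"] by linarith
qed

text \<open>In the product topology on \<open>nat \<Rightarrow> real\<close>, forcing the entries
  from \<open>n\<close> on to be zero places the set inside a product of compact sets, which is
  compact by Tychonoff; closedness then suffices.\<close>

lemma compact_constrained_sphere:
  assumes d: "\<And>i. i < n \<Longrightarrow> d i > 0"
  shows "compact {x. (\<forall>i\<ge>n. x i = 0) \<and> weighted_prod n d x x = 1 \<and>
                     (\<forall>a<k. weighted_prod n d (p a) x = 0)}" (is "compact ?S")
proof -
  \<comment> \<open>From d x^2 <= 1 and |x| <= x^2 + 1 each entry is at most 1 / d + 1 in absolute
    value; this crude bound avoids square roots.\<close>
  let ?B = "PiE UNIV (\<lambda>i. if i < n then {- (1 / d i + 1)..1 / d i + 1} else {0})"
  have "compactin (product_topology (\<lambda>_::nat. euclidean) UNIV) ?B"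
    unfolding compactin_PiE by (auto simp: compactin_euclidean_iff)
  then have "compact ?B" by (simp add: euclidean_product_topology compactin_euclidean_iff)
  moreover have "closed ?S"
    unfolding weighted_prod_def
    by (intro closed_Collect_conj closed_Collect_all closed_Collect_imp closed_Collect_eq
        continuous_intros open_Collect_const) auto
  moreover have "?S \<subseteq> ?B"
  proof
    fix x assume x: "x \<in> ?S"
    have "\<bar>x i\<bar> \<le> 1 / d i + 1" if i: "i < n" for i
    proof -
      have "d i * x i * x i \<le> weighted_prod n d x x"
        unfolding weighted_prod_def using i d
        by (intro member_le_sum) (auto simp: mult.assoc less_imp_le)
      then have "x i * x i \<le> 1 / d i" using x d[OF i] by (simp add: field_simps)
      moreover have "\<bar>x i\<bar> \<le> x i * x i + 1"
        using zero_le_power2[of "\<bar>x i\<bar> - 1"] zero_le_power2[of "x i"] by (simp add: power2_eq_square algebra_simps)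
      ultimately show ?thesis by linarith
    qed
    then show "x \<in> ?B" using x by (force simp: abs_le_iff)
  qed
  ultimately show ?thesis using closed_Int_compact[of ?S ?B] by (simp only: Int_absorb2)
qed

text \<open>
  The new vector maximizes the quadratic form over the unit vectors orthogonal to the given
  ones; the first-order condition at the maximum is the eigenvalue equation.
\<close>

lemma eigenbasis_extend:
  assumes d: "\<And>i. i < n \<Longrightarrow> d i > 0" and sym: "symmetric_on n w"
    and "k < n" and eb: "eigenbasis n d w k p l"
  shows "\<exists>p l. eigenbasis n d w (Suc k) p l"
proof -
  let ?S = "{x. (\<forall>i\<ge>n. x i = 0) \<and> weighted_prod n d x x = 1 \<and> (\<forall>a<k. weighted_prod n d (p a) x = 0)}"
  define Z where "Z = {y. \<forall>a<k. weighted_prod n d (p a) y = 0}"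
  \<comment> \<open>A vector of \<open>Z\<close> that is nonzero below \<open>n\<close> can be cut
    off at \<open>n\<close> and scaled to unit length, which moves it into the compact set
    \<open>?S\<close>.\<close>
  have normalize: "\<exists>c x. c\<^sup>2 = 1 / weighted_prod n d y y \<and> (\<forall>i<n. x i = c * y i) \<and> x \<in> ?S"
    if y: "y \<in> Z" "i < n" "y i \<noteq> 0" for y i
  proof -
    have pos: "weighted_prod n d y y > 0" using weighted_prod_self_pos[of n d i y] d y by auto
    define c where "c = 1 / sqrt (weighted_prod n d y y)"
    have c2: "c\<^sup>2 = 1 / weighted_prod n d y y" using pos by (simp add: c_def power_divide)
    define x where "x = (\<lambda>i. if i < n then c * y i else 0)"
    have "weighted_prod n d x x = c\<^sup>2 * weighted_prod n d y y"
      by (simp add: weighted_prod_def x_def sum_distrib_left power2_eq_square mult_ac)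
    moreover have "weighted_prod n d (p a) x = c * weighted_prod n d (p a) y" for a
      by (simp add: weighted_prod_def x_def sum_distrib_left mult_ac)
    ultimately have "x \<in> ?S" using y pos c2 by (auto simp: Z_def x_def)
    then show ?thesis using c2 by (intro exI[of _ c] exI[of _ x]) (auto simp: x_def)
  qed
  \<comment> \<open>Orthogonality to \<open>k\<close> vectors is a system of \<open>k < n\<close>
    equations in \<open>n\<close> unknowns.\<close>
  obtain y i where "i < n" "y i \<noteq> 0" "y \<in> Z"
    using homogeneous_system_nontrivial[of "{..<k}" "{..<n}" "\<lambda>a i. d i * p a i"] \<open>k < n\<close>
    by (auto simp: Z_def weighted_prod_def)
  then have nonempty: "?S \<noteq> {}" using normalize by blast
  have compact: "compact ?S" using d by (rule compact_constrained_sphere)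
  have cont: "continuous_on ?S (\<lambda>x. quad_form n w x x)"
    unfolding quad_form_def
    by (intro continuous_intros continuous_on_subset[OF continuous_on_product_coordinates]) auto
  obtain x where x: "x \<in> ?S" "\<And>y. y \<in> ?S \<Longrightarrow> quad_form n w y y \<le> quad_form n w x x"
    using continuous_attains_sup[OF compact nonempty cont] by blast
  define m where "m = quad_form n w x x"
  \<comment> \<open>Both sides are homogeneous of degree 2, so maximality on \<open>?S\<close>
    becomes a Rayleigh bound on all of \<open>Z\<close>.\<close>
  have max: "quad_form n w y y \<le> m * weighted_prod n d y y" if y: "y \<in> Z" for y
  proof (cases "\<exists>i<n. y i \<noteq> 0")
    case False
    then show ?thesis by (simp add: quad_form_def weighted_prod_def)
  next
    case True
    then obtain i where i: "i < n" "y i \<noteq> 0" by auto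
    obtain c z where cz: "c\<^sup>2 = 1 / weighted_prod n d y y" "\<And>i. i < n \<Longrightarrow> z i = c * y i" "z \<in> ?S"
      using normalize[OF y i] by blast
    have "quad_form n w z z = c\<^sup>2 * quad_form n w y y"
      by (simp add: quad_form_def cz(2) sum_distrib_left power2_eq_square mult_ac)
    then have "c\<^sup>2 * quad_form n w y y \<le> m" using x(2)[OF cz(3)] by (simp add: m_def)
    moreover have "weighted_prod n d y y > 0" using weighted_prod_self_pos[of n d i y] d i by auto
    ultimately show ?thesis by (simp add: cz(1) field_simps)
  qed
  \<comment> \<open>The perturbation x + t h stays in \<open>Z\<close>, and the Rayleigh bound is an
    equality at t = 0; hence its linear coefficient in t vanishes.\<close>
  have stat: "quad_form n w h x = m * weighted_prod n d h x" if h: "h \<in> Z" for h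
  proof -
    have "2 * t * (quad_form n w h x - m * weighted_prod n d h x) +
        t\<^sup>2 * (quad_form n w h h - m * weighted_prod n d h h) \<le> 0" for t
    proof -
      have "(\<lambda>i. x i + t * h i) \<in> Z" using x(1) h by (auto simp: Z_def weighted_prod_add_right)
      from max[OF this] have "quad_form n w x x + 2 * t * quad_form n w h x + t\<^sup>2 * quad_form n w h h
          \<le> m * (weighted_prod n d x x + 2 * t * weighted_prod n d h x + t\<^sup>2 * weighted_prod n d h h)"
        by (simp add: quad_form_add_left quad_form_add_right weighted_prod_add_left
            weighted_prod_add_right quad_form_commute[OF sym, of x h] weighted_prod_commute[of n d x h]
            power2_eq_square algebra_simps)
      moreover have "m * weighted_prod n d x x = quad_form n w x x" using x(1) by (simp add: m_def)
      ultimately show ?thesis by (simp add: algebra_simps)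
    qed
    then show ?thesis using linear_coeff_zero_if_quadratic_nonpos[of "quad_form n w h x - m * weighted_prod n d h x"]
      by auto
  qed
  have eig_quad: "quad_form n w x (p a) = l a * weighted_prod n d x (p a)" if "a < k" for a x
    using eb that by (simp add: eigenbasis_def quad_form_def weighted_prod_def sum_distrib_left mult_ac)
  have all: "quad_form n w h x = m * weighted_prod n d h x" for h
  proof -
    \<comment> \<open>\<open>g\<close> is the projection of \<open>h\<close> onto the earlier
      eigenvectors. Both forms vanish between \<open>g\<close> and \<open>x\<close>, by the
      eigenvalue equations and symmetry, so \<open>h\<close> may be replaced by h - g, which lies in
      \<open>Z\<close>.\<close>
    define g where "g = (\<lambda>i. \<Sum>a<k. weighted_prod n d (p a) h * p a i)"
    have px: "weighted_prod n d (p a) x = 0" if "a < k" for a using x(1) that by auto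
    have "quad_form n w (p a) x = 0" if "a < k" for a
      using eig_quad[OF that, of x] px[OF that]
      by (simp add: quad_form_commute[OF sym, of "p a"] weighted_prod_commute[of n d x])
    then have g1: "quad_form n w g x = 0" by (simp add: g_def quad_form_sum_left)
    have g2: "weighted_prod n d g x = 0" using px by (simp add: g_def weighted_prod_sum_left)
    have "weighted_prod n d (p a) g = weighted_prod n d (p a) h" if "a < k" for a
    proof -
      have "weighted_prod n d (p a) g = (\<Sum>b<k. weighted_prod n d (p b) h * weighted_prod n d (p b) (p a))"
        by (subst weighted_prod_commute) (simp add: g_def weighted_prod_sum_left)
      also have "\<dots> = (\<Sum>b<k. if b = a then weighted_prod n d (p b) h else 0)"
        using eb that by (intro sum.cong) (auto simp: eigenbasis_def)
      finally show ?thesis using that by simp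
    qed
    then have "weighted_prod n d (p a) (\<lambda>i. h i + (- 1) * g i) = 0" if "a < k" for a
      unfolding weighted_prod_add_right using that by simp
    then have "(\<lambda>i. h i + (- 1) * g i) \<in> Z" by (simp only: Z_def mem_Collect_eq) blast
    from stat[OF this] show ?thesis
      unfolding quad_form_add_left weighted_prod_add_left using g1 g2 by simp
  qed
  have eigx: "(\<Sum>j<n. w i j * x j) = m * d i * x i" if "i < n" for i
  proof -
    have "quad_form n w (\<lambda>j. if j = i then 1 else 0) x = (\<Sum>j<n. w i j * x j)"
      unfolding quad_form_def using that
      by (subst sum.remove[of _ i]) (auto intro!: sum.neutral)
    moreover have "weighted_prod n d (\<lambda>j. if j = i then 1 else 0) x = d i * x i"
      unfolding weighted_prod_def using that
      by (subst sum.remove[of _ i]) (auto intro!: sum.neutral)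
    ultimately show ?thesis using all[of "\<lambda>j. if j = i then 1 else 0"] by simp
  qed
  have "weighted_prod n d x (p a) = 0" if "a < k" for a
    using x(1) that by (subst weighted_prod_commute) simp
  then have "eigenbasis n d w (Suc k) (p(k := x)) (l(k := m))"
    using eb x(1) eigx by (auto simp: eigenbasis_def less_Suc_eq)
  then show ?thesis by blast
qed

lemma eigenbasis_exists:
  assumes "\<And>i. i < n \<Longrightarrow> d i > 0" "symmetric_on n w"
  shows "\<exists>p l. eigenbasis n d w n p l"
proof -
  have "\<exists>p l. eigenbasis n d w k p l" if "k \<le> n" for k
    using that
  proof (induction k)
    case 0
    then show ?case by (simp add: eigenbasis_def)
  next
    case (Suc k)
    then obtain p l where "eigenbasis n d w k p l" by auto
    with eigenbasis_extend[OF assms] Suc.prems show ?case by simp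
  qed
  then show ?thesis by simp
qed

text \<open>With P the matrix of columns \<open>p a\<close> and Q = P^T D, orthonormality reads Q P
  = 1 and the eigenvalue equation reads A P = P \<Lambda>. So A is similar to a diagonal matrix and
  its characteristic polynomial splits over the reals.\<close>

lemma mset_eigenvalue_list_eigenbasis:
  assumes eb: "eigenbasis n d w n p l" and d: "\<And>i. i < n \<Longrightarrow> d i > 0"
    and A: "A \<in> carrier_mat n n"
    and w: "\<And>i j. i < n \<Longrightarrow> j < n \<Longrightarrow> d i * A $$ (i, j) = w i j"
  shows "mset (eigenvalue_list A) = mset (map l [0..<n])"
proof -
  define P where "P = mat n n (\<lambda>(i, a). p a i)"
  define Q where "Q = mat n n (\<lambda>(a, i). d i * p a i)"
  define \<Lambda> where "\<Lambda> = mat n n (\<lambda>(a, b). if a = b then l a else 0)"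
  have carr: "P \<in> carrier_mat n n" "Q \<in> carrier_mat n n" "\<Lambda> \<in> carrier_mat n n"
    by (auto simp: P_def Q_def \<Lambda>_def)
  have QP: "Q * P = 1\<^sub>m n"
  proof (rule eq_matI)
    fix a b assume "a < dim_row (1\<^sub>m n :: real mat)" "b < dim_col (1\<^sub>m n :: real mat)"
    then have ab: "a < n" "b < n" by auto
    have "(Q * P) $$ (a, b) = weighted_prod n d (p a) (p b)"
      using ab by (simp add: Q_def P_def scalar_prod_def weighted_prod_def atLeast0LessThan)
    then show "(Q * P) $$ (a, b) = 1\<^sub>m n $$ (a, b)" using eb ab by (auto simp: eigenbasis_def)
  qed (use carr in auto)
  have PQ: "P * Q = 1\<^sub>m n" using mat_mult_left_right_inverse[OF carr(2,1) QP] .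
  have AP: "A * P = P * \<Lambda>"
  proof (rule eq_matI)
    fix i a assume "i < dim_row (P * \<Lambda>)" "a < dim_col (P * \<Lambda>)"
    then have ia: "i < n" "a < n" using carr by auto
    have "(A * P) $$ (i, a) = (\<Sum>j<n. A $$ (i, j) * p a j)"
      using ia A by (simp add: P_def scalar_prod_def atLeast0LessThan)
    then have "d i * (A * P) $$ (i, a) = (\<Sum>j<n. w i j * p a j)"
      using w ia by (simp add: sum_distrib_left mult.assoc[symmetric])
    also have "\<dots> = d i * (l a * p a i)" using eb ia by (simp add: eigenbasis_def)
    finally have "(A * P) $$ (i, a) = l a * p a i" using d[OF ia(1)] by simp
    moreover have "(P * \<Lambda>) $$ (i, a) = (\<Sum>b<n. p b i * (if b = a then l b else 0))"
      using ia by (simp add: P_def \<Lambda>_def scalar_prod_def atLeast0LessThan)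
    moreover have "\<dots> = p a i * l a" using ia
      by (subst sum.remove[of _ a]) (auto intro!: sum.neutral)
    ultimately show "(A * P) $$ (i, a) = (P * \<Lambda>) $$ (i, a)" by simp
  qed (use carr A in auto)
  have "A = A * (P * Q)" using A by (simp add: PQ)
  also have "\<dots> = P * \<Lambda> * Q" using A carr AP by (metis assoc_mult_mat)
  finally have "similar_mat A \<Lambda>" using A carr PQ QP by (intro similar_matI[of _ _ P Q n]) auto
  then have "char_poly A = char_poly \<Lambda>" by (rule char_poly_similar)
  also have "\<dots> = (\<Prod>a\<leftarrow>diag_mat \<Lambda>. [:- a, 1:])"
    using carr by (intro char_poly_upper_triangular) (auto simp: \<Lambda>_def)
  also have "diag_mat \<Lambda> = map l [0..<n]" by (auto simp: diag_mat_def \<Lambda>_def intro!: map_cong)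
  finally have "proots (char_poly A) = (\<Sum>a\<leftarrow>map l [0..<n]. proots [:- a, 1:])"
    using proots_prod_list[of "map (\<lambda>a. [:- a, 1:]) (map l [0..<n])"] by (simp add: o_def image_iff)
  also have "\<dots> = mset (map l [0..<n])"
  proof -
    have "(\<Sum>a\<leftarrow>xs. proots [:- a, 1:]) = mset xs" for xs :: "real list"
      by (induction xs) (auto simp: proots_linear_factor)
    then show ?thesis .
  qed
  finally show ?thesis by (simp add: eigenvalue_list_def)
qed

section \<open>Comparison of eigenvalue counts\<close>

text \<open>In eigenbasis coordinates both forms are diagonal, so bounds on the eigenvalues in
  \<open>I\<close> bound the Rayleigh quotient on the span of the vectors in
  \<open>I\<close>.\<close>

lemma eigenbasis_sum_forms:
  fixes c :: "nat \<Rightarrow> real"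
  assumes eb: "eigenbasis n d w n p l" and I: "I \<subseteq> {..<n}"
  defines "x \<equiv> (\<lambda>i. \<Sum>a\<in>I. c a * p a i)"
  shows "weighted_prod n d x x = (\<Sum>a\<in>I. (c a)\<^sup>2)"
    and "quad_form n w x x = (\<Sum>a\<in>I. l a * (c a)\<^sup>2)"
proof -
  have fin: "finite I" using I finite_subset by blast
  have coord: "weighted_prod n d (p a) x = c a" if "a \<in> I" for a
  proof -
    have "weighted_prod n d (p a) x = (\<Sum>b\<in>I. c b * weighted_prod n d (p b) (p a))"
      by (subst weighted_prod_commute) (simp add: x_def weighted_prod_sum_left)
    also have "\<dots> = (\<Sum>b\<in>I. if b = a then c b else 0)"
      using eb I that by (intro sum.cong) (auto simp: eigenbasis_def subset_iff)
    finally show ?thesis using that fin by simp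
  qed
  show "weighted_prod n d x x = (\<Sum>a\<in>I. (c a)\<^sup>2)"
    by (subst (1) x_def, subst weighted_prod_sum_left)
       (simp add: coord power2_eq_square)
  have "(\<Sum>j<n. w i j * x j) = (\<Sum>a\<in>I. c a * (l a * d i * p a i))" if "i < n" for i
  proof -
    have "(\<Sum>j<n. w i j * x j) = (\<Sum>a\<in>I. c a * (\<Sum>j<n. w i j * p a j))"
      unfolding x_def sum_distrib_left by (subst sum.swap) (simp add: mult_ac)
    also have "\<dots> = (\<Sum>a\<in>I. c a * (l a * d i * p a i))"
      using eb I that by (intro sum.cong) (auto simp: eigenbasis_def subset_iff)
    finally show ?thesis .
  qed
  then have "quad_form n w x x = (\<Sum>i<n. \<Sum>a\<in>I. c a * l a * (d i * p a i * x i))"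
    unfolding quad_form_def by (intro sum.cong refl) (simp add: sum_distrib_left mult_ac)
  also have "\<dots> = (\<Sum>a\<in>I. c a * l a * weighted_prod n d (p a) x)"
    by (subst sum.swap) (simp add: sum_distrib_left weighted_prod_def)
  also have "\<dots> = (\<Sum>a\<in>I. l a * (c a)\<^sup>2)"
    by (intro sum.cong refl) (simp add: coord power2_eq_square)
  finally show "quad_form n w x x = (\<Sum>a\<in>I. l a * (c a)\<^sup>2)" .
qed

text \<open>
  If the inequality failed, the span of the eigenvectors with \<open>l a > t\<close> and that of the
  eigenvectors with \<open>l' a \<le> s\<close> would have a common nonzero vector vanishing on \<open>bad\<close>, on which
  the two quadratic forms agree.
\<close>

lemma card_eigenvalues_greater_le:
  assumes eb: "eigenbasis n d w n p l" and eb': "eigenbasis n d' w' n p' l'"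
    and bad: "bad \<subseteq> {..<n}"
    and w: "\<And>i j. i < n \<Longrightarrow> j < n \<Longrightarrow> i \<notin> bad \<Longrightarrow> j \<notin> bad \<Longrightarrow> w i j = w' i j"
    and d: "\<And>i. i < n \<Longrightarrow> i \<notin> bad \<Longrightarrow> s * d' i \<le> t * d i"
  shows "card {a. a < n \<and> l a > t} \<le> card {a. a < n \<and> l' a > s} + card bad"
proof (rule ccontr)
  assume contr: "\<not> ?thesis"
  define I where "I = {a. a < n \<and> l a > t}"
  define J where "J = {a. a < n \<and> l' a \<le> s}"
  have fin: "finite I" "finite J" "finite bad" using bad by (auto simp: I_def J_def finite_subset)
  have sub: "I \<subseteq> {..<n}" "J \<subseteq> {..<n}" by (auto simp: I_def J_def)
  have "{a. a < n \<and> l' a > s} = {..<n} - J" by (auto simp: J_def)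
  then have card: "card {a. a < n \<and> l' a > s} + card J = n"
    using sub fin card_mono[OF finite_lessThan sub(2)] by (simp add: card_Diff_subset)
  \<comment> \<open>Unknowns \<open>Inl a\<close> and \<open>Inr a\<close> are the coefficients of a
    vector \<open>x\<close> in the span of the \<open>p a\<close> and of \<open>y\<close> in the
    span of the \<open>p' a\<close>. Equation \<open>Inl i\<close> says that x = y at
    \<open>i\<close>; equation \<open>Inr i\<close> makes x vanish at a point of
    \<open>bad\<close>.\<close>
  define coeff :: "nat + nat \<Rightarrow> nat + nat \<Rightarrow> real" where
    "coeff e u = (case e of
        Inl i \<Rightarrow> (case u of Inl a \<Rightarrow> p a i | Inr a \<Rightarrow> - p' a i)
      | Inr i \<Rightarrow> (case u of Inl a \<Rightarrow> p a i | Inr a \<Rightarrow> 0))" for e u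
  have "card ({..<n} <+> bad) < card (I <+> J)"
    using contr card fin by (simp add: card_Plus I_def)
  then obtain c where c: "\<exists>u\<in>I <+> J. c u \<noteq> 0"
      "\<And>e. e \<in> {..<n} <+> bad \<Longrightarrow> (\<Sum>u\<in>I <+> J. coeff e u * c u) = 0"
    using homogeneous_system_nontrivial[of "{..<n} <+> bad" "I <+> J" coeff] fin by auto
  define x where "x = (\<lambda>i. \<Sum>a\<in>I. c (Inl a) * p a i)"
  define y where "y = (\<lambda>i. \<Sum>a\<in>J. c (Inr a) * p' a i)"
  have split: "(\<Sum>u\<in>I <+> J. coeff e u * c u)
      = (\<Sum>a\<in>I. coeff e (Inl a) * c (Inl a)) + (\<Sum>a\<in>J. coeff e (Inr a) * c (Inr a))" for e
    using fin by (simp add: sum.Plus)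
  have xy: "x i = y i" if "i < n" for i
  proof -
    have "Inl i \<in> {..<n} <+> bad" using that by auto
    from c(2)[OF this] show ?thesis
      unfolding split by (simp add: x_def y_def coeff_def sum_negf mult.commute)
  qed
  have x0: "x i = 0" if "i \<in> bad" for i
  proof -
    have "Inr i \<in> {..<n} <+> bad" using that by auto
    from c(2)[OF this] show ?thesis
      unfolding split by (simp add: x_def coeff_def mult.commute)
  qed
  have forms: "weighted_prod n d x x = (\<Sum>a\<in>I. (c (Inl a))\<^sup>2)"
      "quad_form n w x x = (\<Sum>a\<in>I. l a * (c (Inl a))\<^sup>2)"
      "weighted_prod n d' y y = (\<Sum>a\<in>J. (c (Inr a))\<^sup>2)"
      "quad_form n w' y y = (\<Sum>a\<in>J. l' a * (c (Inr a))\<^sup>2)"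
    unfolding x_def y_def using eigenbasis_sum_forms[OF eb sub(1)] eigenbasis_sum_forms[OF eb' sub(2)] by auto
  have q: "quad_form n w x x = quad_form n w' y y"
  proof -
    have "x i * (w i j * x j) = y i * (w' i j * y j)" if "i < n" "j < n" for i j
      using that xy[of i] xy[of j] x0[of i] x0[of j] w[of i j] by (cases "i \<in> bad \<or> j \<in> bad") auto
    then show ?thesis unfolding quad_form_def sum_distrib_left by (intro sum.cong) auto
  qed
  have dd: "s * weighted_prod n d' y y \<le> t * weighted_prod n d x x"
  proof -
    have "s * (d' i * y i * y i) \<le> t * (d i * x i * x i)" if "i < n" for i
    proof (cases "i \<in> bad")
      case True
      then show ?thesis using x0 xy[OF that] by simp
    next
      case False
      have "s * d' i * (x i * x i) \<le> t * d i * (x i * x i)"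
        using d[OF that False] by (intro mult_right_mono) auto
      then show ?thesis using xy[OF that] by (simp add: mult_ac)
    qed
    then show ?thesis unfolding weighted_prod_def sum_distrib_left by (intro sum_mono) auto
  qed
  have upper: "quad_form n w' y y \<le> s * weighted_prod n d' y y"
    unfolding forms sum_distrib_left by (intro sum_mono mult_right_mono) (auto simp: J_def)
  have lower: "quad_form n w x x > t * weighted_prod n d x x" if "\<exists>a\<in>I. c (Inl a) \<noteq> 0"
  proof -
    from that obtain a where "a \<in> I" "c (Inl a) \<noteq> 0" by auto
    then show ?thesis unfolding forms sum_distrib_left using fin
      by (intro sum_strict_mono_ex1 ballI mult_right_mono bexI[of _ a] mult_strict_right_mono) (auto simp: I_def)
  qed
  \<comment> \<open>A nonzero coefficient on \<open>I\<close> would give t (x,x) < q(x) = q'(y) <= s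
    (y,y)' <= t (x,x). Once x = 0, \<open>y\<close> vanishes below \<open>n\<close> as well, and
    orthonormality kills the coefficients on \<open>J\<close>.\<close>
  have zero: "\<forall>a\<in>I. c (Inl a) = 0" using lower upper q dd by fastforce
  then have "x i = 0" for i by (simp add: x_def)
  then have "weighted_prod n d' y y = 0" using xy by (simp add: weighted_prod_def)
  then have "\<forall>a\<in>J. c (Inr a) = 0" using forms(3) fin by (simp add: sum_nonneg_eq_0_iff)
  with zero c(1) show False by auto
qed

section \<open>Weak convergence of empirical spectral measures\<close>

lemma real_distribution_empirical_spectral_measure:
  assumes "dim_row A > 0"
  shows "real_distribution (empirical_spectral_measure A)"
proof -
  interpret prob_space "uniform_count_measure {..<dim_row A}"
    using assms by (intro prob_space_uniform_count_measure) auto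
  have "prob_space (empirical_spectral_measure A)"
    unfolding empirical_spectral_measure_def
    by (intro prob_space_distr) (simp add: uniform_count_measure_def)
  then show ?thesis
    by (simp add: real_distribution_def real_distribution_axioms_def empirical_spectral_measure_def)
qed

text \<open>Phrased through the eigenvalues above \<open>t\<close> because
  \<open>card_eigenvalues_greater_le\<close> compares those. The order of the enumeration is
  immaterial since only a count is taken.\<close>

lemma cdf_empirical_spectral_measure:
  assumes n: "dim_row A = n" "n > 0"
    and l: "mset (eigenvalue_list A) = mset (map l [0..<n])"
  shows "cdf (empirical_spectral_measure A) t = 1 - real (card {a. a < n \<and> l a > t}) / real n"
proof -
  have len: "length (eigenvalue_list A) = n"
    using arg_cong[OF l, of size] by simp
  have "cdf (empirical_spectral_measure A) t =
      measure (uniform_count_measure {..<n}) {k \<in> {..<n}. eigenvalue_list A ! k \<le> t}"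
    unfolding cdf_def empirical_spectral_measure_def n
    by (subst measure_distr)
       (auto simp: uniform_count_measure_def space_point_measure intro!: arg_cong[where f = "measure _"])
  also have "\<dots> = real (card {k \<in> {..<n}. eigenvalue_list A ! k \<le> t}) / n"
    by (subst measure_uniform_count_measure) auto
  also have "card {k \<in> {..<n}. eigenvalue_list A ! k \<le> t} = length (filter (\<lambda>x. x \<le> t) (eigenvalue_list A))"
    by (simp add: length_filter_conv_card len)
  also have "\<dots> = size (filter_mset (\<lambda>x. x \<le> t) (mset (eigenvalue_list A)))"
    by (metis mset_filter size_mset)
  also have "\<dots> = length (filter (\<lambda>x. x \<le> t) (map l [0..<n]))"
    unfolding l by (metis mset_filter size_mset)
  also have "\<dots> = card {a. a < n \<and> l a \<le> t}"
    by (simp add: length_filter_conv_card cong: conj_cong)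
  also have "\<dots> = n - card {a. a < n \<and> l a > t}"
  proof -
    have "{a. a < n \<and> l a \<le> t} = {..<n} - {a. a < n \<and> l a > t}" by auto
    moreover have "card ({..<n} - {a. a < n \<and> l a > t}) = card {..<n} - card {a. a < n \<and> l a > t}"
      by (rule card_Diff_subset) auto
    ultimately show ?thesis by simp
  qed
  finally have "cdf (empirical_spectral_measure A) t = real (n - card {a. a < n \<and> l a > t}) / n" .
  moreover have "card {a. a < n \<and> l a > t} \<le> n"
    using card_mono[of "{..<n}" "{a. a < n \<and> l a > t}"] by auto
  ultimately show ?thesis using n by (simp add: of_nat_diff diff_divide_distrib)
qed

text \<open>For \<open>n = 0\<close> the empirical measure is not a probability measure; shifting
  the index lets the results on real distributions apply.\<close>

lemma converges_weakly_Suc_iff: "converges_weakly (\<lambda>n. \<nu> (Suc n)) \<mu> \<longleftrightarrow> converges_weakly \<nu> \<mu>"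
proof -
  have "(\<lambda>n. integral\<^sup>L (\<nu> (Suc n)) f) \<longlonglongrightarrow> integral\<^sup>L \<mu> f \<longleftrightarrow>
      (\<lambda>n. integral\<^sup>L (\<nu> n) f) \<longlonglongrightarrow> integral\<^sup>L \<mu> f" for f :: "real \<Rightarrow> real"
    by (rule filterlim_sequentially_Suc)
  then show ?thesis by (simp only: converges_weakly_def)
qed

lemma weak_conv_m_imp_converges_weakly:
  assumes "\<And>n. real_distribution (\<nu> n)" "real_distribution \<mu>" "weak_conv_m \<nu> \<mu>"
  shows "converges_weakly \<nu> \<mu>"
  unfolding converges_weakly_def
proof (intro allI impI)
  fix f :: "real \<Rightarrow> real" assume f: "continuous_on UNIV f" "bounded (range f)"
  then obtain B where "\<And>x. norm (f x) \<le> B" by (auto simp: bounded_iff)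
  moreover have "isCont f x" for x using f(1) by (simp add: continuous_on_eq_continuous_at)
  ultimately show "(\<lambda>n. integral\<^sup>L (\<nu> n) f) \<longlonglongrightarrow> integral\<^sup>L \<mu> f"
    using weak_conv_imp_integral_bdd_continuous_conv[OF assms] by blast
qed

lemma converges_weakly_cts_step:
  assumes "converges_weakly \<nu> \<mu>" "a < b"
  shows "(\<lambda>n. integral\<^sup>L (\<nu> n) (cts_step a b)) \<longlonglongrightarrow> integral\<^sup>L \<mu> (cts_step a b)"
proof -
  have "continuous_on UNIV (cts_step a b)"
    using cts_step_uniformly_continuous[OF assms(2)] by (rule uniformly_continuous_imp_continuous)
  moreover have "bounded (range (cts_step a b))"
    using assms(2) by (intro boundedI[of _ 1]) (auto simp: cts_step_def)
  ultimately show ?thesis using assms(1) by (auto simp: converges_weakly_def)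
qed

text \<open>The continuous ramps \<open>cts_step\<close> lie between indicators of half-lines, so
  weak convergence of \<open>\<nu>\<close> controls its distribution functions up to a horizontal
  shift. Together with the shifts in the hypotheses this traps \<open>cdf (\<nu>' n) t\<close> at a
  continuity point of the limit.\<close>

lemma weak_conv_m_cdf_sandwich:
  assumes \<nu>: "\<And>n. real_distribution (\<nu> n)" and "\<And>n. real_distribution (\<nu>' n)" and \<mu>: "real_distribution \<mu>"
    and conv: "converges_weakly \<nu> \<mu>"
    and lower: "\<And>t h e. h > 0 \<Longrightarrow> e > 0 \<Longrightarrow> \<forall>\<^sub>F n in sequentially. cdf (\<nu> n) (t - h) \<le> cdf (\<nu>' n) t + e"
    and upper: "\<And>t h e. h > 0 \<Longrightarrow> e > 0 \<Longrightarrow> \<forall>\<^sub>F n in sequentially. cdf (\<nu>' n) t \<le> cdf (\<nu> n) (t + h) + e"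
  shows "weak_conv_m \<nu>' \<mu>"
  unfolding weak_conv_m_def weak_conv_def
proof (intro allI impI)
  fix t assume cont: "isCont (cdf \<mu>) t"
  interpret \<mu>: real_distribution \<mu> by fact
  interpret \<nu>: real_distribution "\<nu> n" for n by fact
  show "(\<lambda>n. cdf (\<nu>' n) t) \<longlonglongrightarrow> cdf \<mu> t"
  proof (rule LIMSEQ_I)
    fix e :: real assume "e > 0"
    then have "e / 3 > 0" by simp
    then have "\<exists>r>0. \<forall>s. dist s t < r \<longrightarrow> dist (cdf \<mu> s) (cdf \<mu> t) < e / 3"
      using cont by (simp only: continuous_at_eps_delta)
    then obtain r where r: "r > 0" "\<And>s. \<bar>s - t\<bar> < r \<Longrightarrow> \<bar>cdf \<mu> s - cdf \<mu> t\<bar> < e / 3"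
      unfolding dist_real_def by blast
    \<comment> \<open>One shift \<open>h\<close> is spent on comparing the two sequences and one on
      the ramp; 2 h < r stays within the continuity radius. The error \<open>e\<close> is split
      between comparison, weak convergence and continuity.\<close>
    define h where "h = r / 3"
    have h: "h > 0" "\<bar>cdf \<mu> (t + 2 * h) - cdf \<mu> t\<bar> < e / 3" "\<bar>cdf \<mu> (t - 2 * h) - cdf \<mu> t\<bar> < e / 3"
      using r by (auto simp: h_def)
    have e3: "e / 3 > 0" using \<open>e > 0\<close> by simp
    have ev_upper: "\<forall>\<^sub>F n in sequentially. integral\<^sup>L (\<nu> n) (cts_step (t + h) (t + 2 * h))
        < integral\<^sup>L \<mu> (cts_step (t + h) (t + 2 * h)) + e / 3"
      using e3 h converges_weakly_cts_step[OF conv, of "t + h" "t + 2 * h"]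
      by (intro order_tendstoD(2)) auto
    have ev_lower: "\<forall>\<^sub>F n in sequentially. integral\<^sup>L (\<nu> n) (cts_step (t - 2 * h) (t - h))
        > integral\<^sup>L \<mu> (cts_step (t - 2 * h) (t - h)) - e / 3"
      using e3 h converges_weakly_cts_step[OF conv, of "t - 2 * h" "t - h"]
      by (intro order_tendstoD(1)) auto
    have step_\<nu>: "cdf (\<nu> n) (t + h) \<le> integral\<^sup>L (\<nu> n) (cts_step (t + h) (t + 2 * h))"
      "integral\<^sup>L (\<nu> n) (cts_step (t - 2 * h) (t - h)) \<le> cdf (\<nu> n) (t - h)" for n
      by (rule \<nu>.cdf_cts_step; use h(1) in simp)+
    have step_\<mu>: "integral\<^sup>L \<mu> (cts_step (t + h) (t + 2 * h)) \<le> cdf \<mu> (t + 2 * h)"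
      "cdf \<mu> (t - 2 * h) \<le> integral\<^sup>L \<mu> (cts_step (t - 2 * h) (t - h))"
      by (rule \<mu>.cdf_cts_step; use h(1) in simp)+
    from ev_upper ev_lower lower[OF h(1) e3, of t] upper[OF h(1) e3, of t]
    have "\<forall>\<^sub>F n in sequentially. \<bar>cdf (\<nu>' n) t - cdf \<mu> t\<bar> < e"
    proof eventually_elim
      case (elim n)
      then show ?case using step_\<nu>[of n] step_\<mu> h(2,3) unfolding abs_less_iff by linarith
    qed
    then show "\<exists>N. \<forall>n\<ge>N. norm (cdf (\<nu>' n) t - cdf \<mu> t) < e"
      by (simp add: eventually_sequentially)
  qed
qed

section \<open>Comparing the Markov matrix with the symmetric matrix\<close>

text \<open>A nonnegative row with zero sum vanishes, and by symmetry so does its column; hence the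
  diagonal entries put in for zero rows do not break symmetry.\<close>

lemma markov_matrix_weights_symmetric:
  assumes sym: "\<And>i j. u j i = u i j" and nonneg: "\<And>i j. (0::real) \<le> u i j"
  shows "symmetric_on n (\<lambda>i j. if row_sum u n i = 0 then (if i = j then b else 0) else c * u i j)"
proof -
  have zero: "u i j = 0" if "row_sum u n i = 0" "j < n" for i j
    using that nonneg by (simp add: row_sum_def sum_nonneg_eq_0_iff)
  show ?thesis unfolding symmetric_on_def
  proof (intro allI impI)
    fix i j assume "i < n" "j < n"
    then show "(if row_sum u n i = 0 then (if i = j then b else 0) else c * u i j) =
        (if row_sum u n j = 0 then (if j = i then b else 0) else c * u j i)"
      using zero[of i j] zero[of j i] sym[of i j] by auto
  qed
qed

text \<open>The scaled Markov matrix solves the eigenvalue problem of the form a U relative to the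
  row averages, the symmetric matrix that relative to the weight 1. On rows with average within
  \<delta> of 1 the two weights times \<open>t\<close> differ by at most \<open>h\<close>; the other
  rows are the exceptional set.\<close>

lemma card_scaled_eigenvalues:
  fixes a :: real
  assumes sym: "\<And>i j. u j i = u i j" and nonneg: "\<And>i j. (0::real) \<le> u i j" and n: "n > 0"
  obtains l l' where
    "mset (eigenvalue_list (a \<cdot>\<^sub>m mat n n (\<lambda>(i, j). u i j))) = mset (map l [0..<n])"
    "mset (eigenvalue_list ((real n * a) \<cdot>\<^sub>m markov_matrix u n)) = mset (map l' [0..<n])"
    "\<And>t h \<delta>. \<bar>t\<bar> * \<delta> \<le> h \<Longrightarrow> \<delta> < 1 \<Longrightarrow>
       card {k. k < n \<and> l' k > t} \<le> card {k. k < n \<and> l k > t - h} + card {i. i < n \<and> \<bar>row_sum u n i / n - 1\<bar> > \<delta>}"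
    "\<And>t h \<delta>. \<bar>t\<bar> * \<delta> \<le> h \<Longrightarrow> \<delta> < 1 \<Longrightarrow>
       card {k. k < n \<and> l k > t + h} \<le> card {k. k < n \<and> l' k > t} + card {i. i < n \<and> \<bar>row_sum u n i / n - 1\<bar> > \<delta>}"
proof -
  let ?r = "row_sum u n"
  define w where "w = (\<lambda>i j. a * u i j)"
  \<comment> \<open>A zero row of the Markov matrix is an identity row; weight 1 and diagonal entry
    \<open>real n * a\<close> reproduce it after scaling. As \<delta> < 1, such rows always count as
    exceptional.\<close>
  define d' where "d' = (\<lambda>i. if ?r i = 0 then 1 else ?r i / n)"
  define w' where "w' = (\<lambda>i j. if ?r i = 0 then (if i = j then real n * a else 0) else a * u i j)"
  have r: "?r i \<ge> 0" for i using nonneg by (simp add: row_sum_def sum_nonneg)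
  have d': "d' i > 0" for i using n r[of i] by (cases "?r i = 0") (auto simp: d'_def intro!: divide_pos_pos)
  have "symmetric_on n w" using sym by (simp add: symmetric_on_def w_def)
  then obtain p l where eb: "eigenbasis n (\<lambda>_. 1) w n p l"
    using eigenbasis_exists[of n "\<lambda>_. 1" w] by auto
  have "symmetric_on n w'" unfolding w'_def using sym nonneg by (rule markov_matrix_weights_symmetric)
  then obtain p' l' where eb': "eigenbasis n d' w' n p' l'"
    using eigenbasis_exists[of n d' w'] d' by auto
  have good: "?r i \<noteq> 0 \<and> \<bar>t * d' i - t\<bar> \<le> h"
    if "\<bar>t\<bar> * \<delta> \<le> h" "\<delta> < 1" "\<not> \<bar>?r i / n - 1\<bar> > \<delta>" for i t h \<delta>
  proof -
    have "?r i \<noteq> 0" using that by auto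
    then have "\<bar>t * d' i - t\<bar> = \<bar>t\<bar> * \<bar>?r i / n - 1\<bar>"
      by (simp add: d'_def abs_mult[symmetric] right_diff_distrib)
    also have "\<dots> \<le> \<bar>t\<bar> * \<delta>" using that by (intro mult_left_mono) auto
    finally show ?thesis using that \<open>?r i \<noteq> 0\<close> by simp
  qed
  show ?thesis
  proof (rule that)
    show "mset (eigenvalue_list (a \<cdot>\<^sub>m mat n n (\<lambda>(i, j). u i j))) = mset (map l [0..<n])"
      by (rule mset_eigenvalue_list_eigenbasis[OF eb]) (auto simp: w_def)
    show "mset (eigenvalue_list ((real n * a) \<cdot>\<^sub>m markov_matrix u n)) = mset (map l' [0..<n])"
      using n by (intro mset_eigenvalue_list_eigenbasis[OF eb' d']) (auto simp: markov_matrix_def d'_def w'_def)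
  next
    fix t h \<delta> :: real assume \<delta>: "\<bar>t\<bar> * \<delta> \<le> h" "\<delta> < 1"
    show "card {k. k < n \<and> l' k > t} \<le> card {k. k < n \<and> l k > t - h} + card {i. i < n \<and> \<bar>?r i / n - 1\<bar> > \<delta>}"
      using good[OF \<delta>] by (intro card_eigenvalues_greater_le[OF eb' eb]) (fastforce simp: w_def w'_def abs_le_iff)+
    show "card {k. k < n \<and> l k > t + h} \<le> card {k. k < n \<and> l' k > t} + card {i. i < n \<and> \<bar>?r i / n - 1\<bar> > \<delta>}"
      using good[OF \<delta>] by (intro card_eigenvalues_greater_le[OF eb eb']) (fastforce simp: w_def w'_def abs_le_iff)+
  qed
qed

text \<open>Dividing the count comparison by \<open>n\<close> gives a comparison of distribution
  functions up to the shift \<open>h\<close> and the proportion of exceptional rows, which tends to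
  0.\<close>

lemma converges_weakly_markov_matrix:
  fixes a :: "nat \<Rightarrow> real"
  assumes sym: "\<And>i j. u j i = u i j" and nonneg: "\<And>i j. (0::real) \<le> u i j"
    and rows: "\<And>\<delta>. \<delta> > 0 \<Longrightarrow> (\<lambda>n. real (card {i. i < n \<and> \<bar>row_sum u n i / n - 1\<bar> > \<delta>}) / n) \<longlonglongrightarrow> 0"
    and \<mu>: "real_distribution \<mu>"
    and conv: "converges_weakly (\<lambda>n. empirical_spectral_measure (a n \<cdot>\<^sub>m mat n n (\<lambda>(i, j). u i j))) \<mu>"
  shows "converges_weakly (\<lambda>n. empirical_spectral_measure ((real n * a n) \<cdot>\<^sub>m markov_matrix u n)) \<mu>"
proof -
  define A where "A n = a n \<cdot>\<^sub>m mat n n (\<lambda>(i, j). u i j)" for n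
  define B where "B n = (real n * a n) \<cdot>\<^sub>m markov_matrix u n" for n
  let ?bad = "\<lambda>\<delta> n. card {i. i < n \<and> \<bar>row_sum u n i / n - 1\<bar> > \<delta>}"
  have dim: "dim_row (A n) = n" "dim_row (B n) = n" for n
    by (auto simp: A_def B_def markov_matrix_def)
  have real: "real_distribution (empirical_spectral_measure (A (Suc n)))"
    "real_distribution (empirical_spectral_measure (B (Suc n)))" for n
    by (intro real_distribution_empirical_spectral_measure, simp add: dim)+
  have cdf: "cdf (empirical_spectral_measure (A n)) (t - h) \<le> cdf (empirical_spectral_measure (B n)) t + ?bad \<delta> n / n \<and>
      cdf (empirical_spectral_measure (B n)) t \<le> cdf (empirical_spectral_measure (A n)) (t + h) + ?bad \<delta> n / n"
    if that: "n > 0" "\<bar>t\<bar> * \<delta> \<le> h" "\<delta> < 1" for n t h \<delta>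
  proof (rule card_scaled_eigenvalues[where u = u and n = n and a = "a n", OF sym nonneg that(1),
        folded A_def B_def])
    fix l l' assume l: "mset (eigenvalue_list (A n)) = mset (map l [0..<n])"
        "mset (eigenvalue_list (B n)) = mset (map l' [0..<n])"
      and card: "\<And>t h \<delta>. \<bar>t\<bar> * \<delta> \<le> h \<Longrightarrow> \<delta> < 1 \<Longrightarrow>
         card {k. k < n \<and> l' k > t} \<le> card {k. k < n \<and> l k > t - h} + ?bad \<delta> n"
        "\<And>t h \<delta>. \<bar>t\<bar> * \<delta> \<le> h \<Longrightarrow> \<delta> < 1 \<Longrightarrow>
         card {k. k < n \<and> l k > t + h} \<le> card {k. k < n \<and> l' k > t} + ?bad \<delta> n"
    note c = cdf_empirical_spectral_measure[OF dim(1) that(1) l(1)]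
      cdf_empirical_spectral_measure[OF dim(2) that(1) l(2)]
    have scale: "1 - real x / n \<le> 1 - real y / n + real z / n" if "y \<le> x + z" for x y z :: nat
    proof -
      have "real y / n \<le> real (x + z) / n" using that by (intro divide_right_mono) auto
      then show ?thesis by (simp add: add_divide_distrib)
    qed
    show ?thesis unfolding c
      using card(1)[OF that(2,3), THEN scale] card(2)[OF that(2,3), THEN scale] by simp
  qed
  have ev: "\<exists>\<delta>. \<bar>t\<bar> * \<delta> \<le> h \<and> \<delta> < 1 \<and> (\<forall>\<^sub>F n in sequentially. ?bad \<delta> (Suc n) / Suc n < e)"
    if "h > 0" "e > 0" for t h e :: real
  proof (intro exI conjI)
    \<comment> \<open>Chosen so that |t| \<delta> <= h; the \<open>+ 1\<close> covers t = 0, and 1 /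
      2 keeps \<delta> below 1.\<close>
    define \<delta> where "\<delta> = min (1 / 2) (h / (\<bar>t\<bar> + 1))"
    have \<delta>: "\<delta> > 0" using that by (simp add: \<delta>_def)
    have "\<bar>t\<bar> * \<delta> \<le> \<bar>t\<bar> * (h / (\<bar>t\<bar> + 1))" by (intro mult_left_mono) (auto simp: \<delta>_def)
    also have "\<dots> \<le> h" using that by (simp add: field_simps)
    finally show "\<bar>t\<bar> * \<delta> \<le> h" .
    show "\<delta> < 1" by (simp add: \<delta>_def)
    have "(\<lambda>n. real (?bad \<delta> (Suc n)) / Suc n) \<longlonglongrightarrow> 0" using LIMSEQ_Suc[OF rows[OF \<delta>]] .
    then show "\<forall>\<^sub>F n in sequentially. ?bad \<delta> (Suc n) / Suc n < e" using \<open>e > 0\<close> by (rule order_tendstoD)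
  qed
  have "weak_conv_m (\<lambda>n. empirical_spectral_measure (B (Suc n))) \<mu>"
  proof (rule weak_conv_m_cdf_sandwich[OF real \<mu>])
    show "converges_weakly (\<lambda>n. empirical_spectral_measure (A (Suc n))) \<mu>"
      using converges_weakly_Suc_iff[of "\<lambda>n. empirical_spectral_measure (A n)"] conv by (simp add: A_def)
  next
    fix t h e :: real assume "h > 0" "e > 0"
    then obtain \<delta> where \<delta>: "\<bar>t\<bar> * \<delta> \<le> h" "\<delta> < 1" "\<forall>\<^sub>F n in sequentially. ?bad \<delta> (Suc n) / Suc n < e"
      using ev by blast
    show "\<forall>\<^sub>F n in sequentially. cdf (empirical_spectral_measure (A (Suc n))) (t - h)
        \<le> cdf (empirical_spectral_measure (B (Suc n))) t + e"
      using \<delta>(3)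
    proof eventually_elim
      case (elim n)
      then show ?case using cdf[of "Suc n" t \<delta> h] \<delta> by linarith
    qed
    show "\<forall>\<^sub>F n in sequentially. cdf (empirical_spectral_measure (B (Suc n))) t
        \<le> cdf (empirical_spectral_measure (A (Suc n))) (t + h) + e"
      using \<delta>(3)
    proof eventually_elim
      case (elim n)
      then show ?case using cdf[of "Suc n" t \<delta> h] \<delta> by linarith
    qed
  qed
  then have "converges_weakly (\<lambda>n. empirical_spectral_measure (B (Suc n))) \<mu>"
    using real \<mu> by (intro weak_conv_m_imp_converges_weakly)
  then show ?thesis
    using converges_weakly_Suc_iff[of "\<lambda>n. empirical_spectral_measure (B n)"] by (simp add: B_def)
qed

section \<open>Sums over an i.i.d. symmetric table\<close>

text \<open>
  Makes both the truncation errors and the variances of dyadic partial sums summable under a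
  first moment alone.
\<close>

lemma sum_truncated_squares_le:
  fixes r :: real
  assumes "r \<ge> 0"
  shows "(\<Sum>k<K. (min r (4 ^ k))\<^sup>2 / 4 ^ k) \<le> 3 * r"
proof -
  define S where "S K r = (\<Sum>k<K. (min r (4 ^ k))\<^sup>2 / 4 ^ k)" for K and r :: real
  have small: "S K r \<le> 4 / 3 * r\<^sup>2" if "r \<ge> 0" for K r
  proof -
    have "S K r \<le> (\<Sum>k<K. r\<^sup>2 * (1 / 4) ^ k)"
      unfolding S_def using that
      by (intro sum_mono) (auto simp: power_divide intro!: divide_right_mono power_mono)
    also have "\<dots> = r\<^sup>2 * (\<Sum>k<K. (1 / 4) ^ k)" by (simp add: sum_distrib_left)
    also have "\<dots> \<le> r\<^sup>2 * (4 / 3)" by (intro mult_left_mono) (auto simp: sum_gp_strict)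
    finally show ?thesis by simp
  qed
  \<comment> \<open>Rescaling \<open>r\<close> by 4 shifts the sum by one index.\<close>
  have rec: "S (Suc K) r = (min r 1)\<^sup>2 + 4 * S K (r / 4)" for K r
  proof -
    have "(min r (4 ^ Suc k))\<^sup>2 / 4 ^ Suc k = 4 * ((min (r / 4) (4 ^ k))\<^sup>2 / 4 ^ k)" for k
    proof -
      have "min r (4 ^ Suc k) = 4 * min (r / 4) (4 ^ k)" by (simp add: min_def)
      then show ?thesis by (simp add: power_mult_distrib)
    qed
    then show ?thesis unfolding S_def sum.lessThan_Suc_shift by (simp add: sum_distrib_left)
  qed
  \<comment> \<open>The term - 1 / 3 closes the induction: 1 + 4 (3 (r / 4) - 1 / 3) = 3 r - 1 / 3.
    For r < 4 the rescaled value is below 1, and the geometric bound \<open>small\<close> takes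
    over.\<close>
  have large: "S K r \<le> 3 * r - 1 / 3" if "r \<ge> 1" for K r
    using that
  proof (induction K arbitrary: r)
    case 0
    then show ?case by (simp add: S_def)
  next
    case (Suc K)
    show ?case
    proof (cases "r \<ge> 4")
      case True
      with Suc.IH[of "r / 4"] show ?thesis by (simp add: rec)
    next
      case False
      have "(r - 1) * (r - 4) \<le> 0" using False Suc.prems by (simp add: mult_nonneg_nonpos)
      then show ?thesis using small[of "r / 4" K] Suc.prems
        by (simp add: rec power2_eq_square algebra_simps)
    qed
  qed
  show ?thesis
  proof (cases "r \<ge> 1")
    case True
    then show ?thesis using large[of r K] by (simp add: S_def)
  next
    case False
    then have "r\<^sup>2 \<le> r" using assms by (simp add: power2_eq_square mult_left_le)
    then show ?thesis using small[OF assms, of K] assms by (simp add: S_def)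
  qed
qed

section \<open>One-sided strong law along dyadic sizes\<close>

text \<open>Centred independent variables are orthogonal, so variances add, and each is at most the
  second moment. Boundedness by \<open>B\<close> supplies the integrability.\<close>

lemma (in prob_space) variance_sum_indep_le:
  fixes X :: "'i \<Rightarrow> 'a \<Rightarrow> real"
  assumes fin: "finite I" and indep: "indep_vars (\<lambda>_. borel) X I"
    and bounded: "\<And>i x. i \<in> I \<Longrightarrow> \<bar>X i x\<bar> \<le> B"
  shows "variance (\<lambda>x. \<Sum>i\<in>I. X i x) \<le> (\<Sum>i\<in>I. expectation (\<lambda>x. (X i x)\<^sup>2))"
proof -
  have rv [measurable]: "random_variable borel (X i)" if "i \<in> I" for i
    using indep that by (auto simp: indep_vars_def)
  have int: "integrable M (X i)" if "i \<in> I" for i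
    using that bounded by (intro integrable_const_bound[of _ B]) auto
  define Z where "Z i x = X i x - expectation (X i)" for i x
  have int_Z: "integrable M (Z i)" if "i \<in> I" for i unfolding Z_def using int[OF that] by auto
  have Z0: "expectation (Z i) = 0" if "i \<in> I" for i
    using int[OF that] by (simp add: Z_def[abs_def] prob_space)
  have indep_Z: "indep_vars (\<lambda>_. borel) Z I"
    unfolding Z_def by (rule indep_vars_compose2[OF indep]) auto
  have cross: "expectation (\<lambda>x. Z i x * Z j x) = (if i = j then variance (X i) else 0)
      \<and> integrable M (\<lambda>x. Z i x * Z j x)"
    if "i \<in> I" "j \<in> I" for i j
  proof (cases "i = j")
    case True
    have Z_bound: "\<bar>Z i x\<bar> \<le> B + \<bar>expectation (X i)\<bar>" for x
      unfolding Z_def using bounded[OF that(1), of x] by linarith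
    have "\<bar>Z i x * Z j x\<bar> \<le> (B + \<bar>expectation (X i)\<bar>) * (B + \<bar>expectation (X i)\<bar>)" for x
      unfolding True[symmetric] abs_mult
      by (intro mult_mono Z_bound order_trans[OF abs_ge_zero Z_bound[of x]] abs_ge_zero)
    moreover have "random_variable borel (Z i)" "random_variable borel (Z j)"
      using that int_Z by auto
    ultimately have "integrable M (\<lambda>x. Z i x * Z j x)"
      by (intro integrable_const_bound[of _ "(B + \<bar>expectation (X i)\<bar>) * (B + \<bar>expectation (X i)\<bar>)"]) auto
    then show ?thesis using True by (simp add: Z_def power2_eq_square)
  next
    case False
    have "indep_vars (\<lambda>_. borel) Z {i, j}"
      using that by (intro indep_vars_subset[OF indep_Z]) auto
    then have "expectation (\<lambda>x. \<Prod>k\<in>{i, j}. Z k x) = (\<Prod>k\<in>{i, j}. expectation (Z k))"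
      "integrable M (\<lambda>x. \<Prod>k\<in>{i, j}. Z k x)"
      using that int_Z indep_vars_lebesgue_integral[of "{i, j}" Z] indep_vars_integrable[of "{i, j}" Z]
      by auto
    then show ?thesis using False Z0[OF that(1)] by simp
  qed
  have "variance (\<lambda>x. \<Sum>i\<in>I. X i x) = expectation (\<lambda>x. (\<Sum>i\<in>I. Z i x)\<^sup>2)"
    using int by (simp add: Z_def sum_subtractf Bochner_Integration.integral_sum)
  also have "\<dots> = expectation (\<lambda>x. \<Sum>i\<in>I. \<Sum>j\<in>I. Z i x * Z j x)"
    by (simp add: power2_eq_square sum_product)
  also have "\<dots> = (\<Sum>i\<in>I. \<Sum>j\<in>I. expectation (\<lambda>x. Z i x * Z j x))"
    using cross by (subst Bochner_Integration.integral_sum; auto)+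
  also have "\<dots> = (\<Sum>i\<in>I. \<Sum>j\<in>I. if i = j then variance (X i) else 0)"
    using cross by (intro sum.cong refl) auto
  also have "\<dots> = (\<Sum>i\<in>I. variance (X i))"
    using fin by simp
  also have "\<dots> \<le> (\<Sum>i\<in>I. expectation (\<lambda>x. (X i x)\<^sup>2))"
  proof (rule sum_mono)
    fix i assume i: "i \<in> I"
    have "\<bar>(X i x)\<^sup>2\<bar> \<le> B\<^sup>2" for x
      using bounded[OF i, of x] by (simp add: abs_le_square_iff[symmetric])
    then have "integrable M (\<lambda>x. (X i x)\<^sup>2)"
      using i by (intro integrable_const_bound[of _ "B\<^sup>2"]) auto
    then show "variance (X i) \<le> expectation (\<lambda>x. (X i x)\<^sup>2)"
      using int[OF i] by (simp add: variance_eq)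
  qed
  finally show ?thesis .
qed

text \<open>Values are truncated at 4^k. The probability that some value exceeds this level and that
  of a large deviation of the truncated sum are both at most a constant times \<open>b k\<close>, a
  summable series; Borel-Cantelli finishes. As only an upper bound is claimed, the truncated mean
  may be replaced by the larger \<open>expectation Y\<close>.\<close>

lemma (in prob_space) dyadic_sums_eventually_le:
  fixes X :: "'i \<Rightarrow> 'a \<Rightarrow> real" and I :: "nat \<Rightarrow> 'i set"
  assumes indep: "indep_vars (\<lambda>_. borel) X J"
    and rv [measurable]: "random_variable borel Y"
    and distr: "\<And>i. i \<in> J \<Longrightarrow> distr M borel (X i) = distr M borel Y"
    and nonneg: "\<And>i x. X i x \<ge> 0" "\<And>x. Y x \<ge> 0"
    and int: "integrable M Y"
    and I: "\<And>k. finite (I k)" "\<And>k. I k \<subseteq> J" "\<And>k. card (I k) \<le> 4 ^ k"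
    and "c > 0"
  shows "AE x in M. \<forall>\<^sub>F k in sequentially. (\<Sum>i\<in>I k. X i x) \<le> 4 ^ k * (expectation Y + c)"
proof -
  have rv_X [measurable]: "random_variable borel (X i)" if "i \<in> J" for i
    using indep that by (auto simp: indep_vars_def)
  have transfer: "expectation (\<lambda>x. h (X i x)) = expectation (\<lambda>x. h (Y x))"
    if "i \<in> J" "h \<in> borel_measurable borel" for i and h :: "real \<Rightarrow> real"
  proof -
    have "expectation (\<lambda>x. h (X i x)) = integral\<^sup>L (distr M borel (X i)) h"
      using that by (subst integral_distr) auto
    also have "\<dots> = expectation (\<lambda>x. h (Y x))"
      using that by (subst distr, simp, subst integral_distr) auto
    finally show ?thesis .
  qed
  define g where "g k y = min y (4 ^ k)" for k and y :: real
  have [measurable]: "g k \<in> borel_measurable borel" for k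
    unfolding g_def by measurable
  have g: "0 \<le> g k y \<and> g k y \<le> 4 ^ k \<and> g k y \<le> y" if "y \<ge> 0" for k y
    using that by (auto simp: g_def)
  have g2: "(g k y)\<^sup>2 \<le> (4 ^ k)\<^sup>2" if "y \<ge> 0" for k y
    using g[OF that, of k] by (intro power_mono) auto
  have int_sq: "integrable M (\<lambda>x. (g k (Z x))\<^sup>2 * r)"
    if [measurable]: "random_variable borel Z" and "\<And>x. Z x \<ge> 0" for k r Z
    using g2 that(2) by (intro integrable_mult_left integrable_const_bound[of _ "(4 ^ k)\<^sup>2"]) auto
  define b where "b k = expectation (\<lambda>x. (g k (Y x))\<^sup>2 / 4 ^ k)" for k
  have b_nonneg: "b k \<ge> 0" for k unfolding b_def by (intro Bochner_Integration.integral_nonneg) auto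
  have b_X: "expectation (\<lambda>x. (g k (X i x))\<^sup>2) = 4 ^ k * b k" if "i \<in> I k" for i k
    using transfer[of i "\<lambda>y. (g k y)\<^sup>2"] that I(2)[of k] by (auto simp: b_def)
  have summable_b: "summable b"
  proof (rule summableI_nonneg_bounded[OF b_nonneg])
    fix K
    have "(\<Sum>k<K. b k) = expectation (\<lambda>x. \<Sum>k<K. (g k (Y x))\<^sup>2 / 4 ^ k)"
      unfolding b_def using int_sq[OF rv nonneg(2), of _ "inverse (4 ^ _)"]
      by (subst Bochner_Integration.integral_sum) (auto simp: divide_inverse)
    also have "\<dots> \<le> expectation (\<lambda>x. 3 * Y x)"
    proof (rule Bochner_Integration.integral_mono)
      show "integrable M (\<lambda>x. \<Sum>k<K. (g k (Y x))\<^sup>2 / 4 ^ k)"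
        using int_sq[OF rv nonneg(2), of _ "inverse (4 ^ _)"]
        by (intro Bochner_Integration.integrable_sum) (auto simp: divide_inverse)
    qed (use int nonneg sum_truncated_squares_le in \<open>auto simp: g_def\<close>)
    finally show "(\<Sum>k<K. b k) \<le> 3 * expectation Y" by simp
  qed
  define large where "large k = (\<Union>i\<in>I k. {x \<in> space M. X i x > 4 ^ k})" for k
  have rv_I: "random_variable borel (X i)" if "i \<in> I k" for i k using that I(2)[of k] by auto
  have exceed_sets: "{x \<in> space M. X i x > 4 ^ k} \<in> events" if "i \<in> I k" for i k
  proof -
    note rv_I[OF that, measurable]
    show ?thesis by measurable
  qed
  have large_sets [measurable]: "large k \<in> events" for k
    unfolding large_def using I(1) exceed_sets by (intro sets.finite_UN) auto
  \<comment> \<open>Where a value exceeds 4^k its truncated square equals (4^k)^2, so by Markov's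
    inequality each index costs b k / 4^k, and there are at most 4^k indices.\<close>
  have prob_large: "prob (large k) \<le> b k" for k
  proof -
    have "prob (large k) \<le> (\<Sum>i\<in>I k. prob {x \<in> space M. X i x > 4 ^ k})"
      unfolding large_def using I(1) exceed_sets by (intro finite_measure_subadditive_finite) auto
    also have "\<dots> \<le> (\<Sum>i\<in>I k. b k / 4 ^ k)"
    proof (rule sum_mono)
      fix i assume i: "i \<in> I k"
      note rv_I[OF i, measurable]
      have "prob {x \<in> space M. X i x > 4 ^ k} = expectation (indicator {x \<in> space M. X i x > 4 ^ k})"
        by simp
      also have "\<dots> \<le> expectation (\<lambda>x. (g k (X i x))\<^sup>2 * (1 / (4 ^ k)\<^sup>2))"
      proof (rule Bochner_Integration.integral_mono)
        show "integrable M (indicator {x \<in> space M. X i x > 4 ^ k} :: 'a \<Rightarrow> real)"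
          using exceed_sets[OF i] by (intro integrable_real_indicator) (auto simp: less_top[symmetric])
        show "integrable M (\<lambda>x. (g k (X i x))\<^sup>2 * (1 / (4 ^ k)\<^sup>2))"
          using nonneg(1) by (intro int_sq) auto
      qed (auto simp: g_def indicator_def split: split_indicator)
      also have "\<dots> = b k / 4 ^ k"
        using b_X[OF i] by (simp add: power2_eq_square)
      finally show "prob {x \<in> space M. X i x > 4 ^ k} \<le> b k / 4 ^ k" .
    qed
    also have "\<dots> = card (I k) / 4 ^ k * b k" by simp
    also have "\<dots> \<le> 1 * b k"
    proof (intro mult_right_mono b_nonneg)
      have "real (card (I k)) \<le> real (4 ^ k)" using I(3)[of k] by (simp only: of_nat_le_iff)
      then show "card (I k) / 4 ^ k \<le> 1" by simp
    qed
    finally show ?thesis by simp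
  qed
  define W where "W k x = (\<Sum>i\<in>I k. g k (X i x))" for k x
  have W_rv [measurable]: "random_variable borel (W k)" for k
    unfolding W_def using rv_I by (intro borel_measurable_sum) auto
  define dev where "dev k = {x \<in> space M. \<bar>W k x - expectation (W k)\<bar> \<ge> 4 ^ k * c}" for k
  have dev_sets [measurable]: "dev k \<in> events" for k unfolding dev_def by measurable
  have card_le: "real (card (I k)) \<le> 4 ^ k" for k
    using I(3)[of k] by (metis of_nat_le_iff of_nat_numeral of_nat_power)
  \<comment> \<open>Chebyshev: a variance of at most 4^k (4^k b k) against the squared deviation
    (4^k c)^2.\<close>
  have prob_dev: "prob (dev k) \<le> b k / c\<^sup>2" for k
  proof -
    have "\<bar>W k x\<bar> \<le> (\<Sum>i\<in>I k. 4 ^ k)" for x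
      unfolding W_def using nonneg(1) g by (intro order_trans[OF sum_abs] sum_mono) auto
    then have "\<bar>(W k x)\<^sup>2\<bar> \<le> (\<Sum>i\<in>I k. 4 ^ k)\<^sup>2" for x
      by (simp add: abs_le_square_iff[symmetric])
    then have "integrable M (\<lambda>x. (W k x)\<^sup>2)"
      by (intro integrable_const_bound[of _ "(\<Sum>i\<in>I k. 4 ^ k)\<^sup>2"]) auto
    then have "prob (dev k) \<le> variance (W k) / (4 ^ k * c)\<^sup>2"
      unfolding dev_def using \<open>c > 0\<close> by (intro Chebyshev_inequality) auto
    also have "variance (W k) \<le> (\<Sum>i\<in>I k. expectation (\<lambda>x. (g k (X i x))\<^sup>2))"
      unfolding W_def
    proof (rule variance_sum_indep_le[OF I(1), where B = "4 ^ k"])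
      show "indep_vars (\<lambda>_. borel) (\<lambda>i x. g k (X i x)) (I k)"
        by (rule indep_vars_compose2[OF indep_vars_subset[OF indep I(2)]]) auto
    qed (use nonneg(1) g in auto)
    also have "\<dots> = card (I k) * (4 ^ k * b k)" using b_X by simp
    also have "\<dots> \<le> 4 ^ k * (4 ^ k * b k)"
      using card_le b_nonneg by (intro mult_right_mono) auto
    also have "4 ^ k * (4 ^ k * b k) / (4 ^ k * c)\<^sup>2 = b k / c\<^sup>2"
      using \<open>c > 0\<close> by (simp add: field_simps power2_eq_square)
    finally show ?thesis by (simp add: divide_right_mono)
  qed
  have AE: "AE x in M. \<forall>\<^sub>F k in sequentially. x \<in> space M - (large k \<union> dev k)"
  proof (rule borel_cantelli_AE1)
    show "summable (\<lambda>k. prob (large k \<union> dev k))"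
    proof (rule summable_comparison_test')
      show "summable (\<lambda>k. b k + b k / c\<^sup>2)" using summable_b by (intro summable_add summable_divide)
      fix k :: nat
      have "prob (large k \<union> dev k) \<le> prob (large k) + prob (dev k)"
        by (rule measure_Un_le) auto
      then show "norm (prob (large k \<union> dev k)) \<le> b k + b k / c\<^sup>2"
        using prob_large[of k] prob_dev[of k] by simp
    qed
  qed (auto simp: less_top[symmetric])
  \<comment> \<open>Off \<open>large k\<close> truncation changes nothing; off \<open>dev k\<close>
    the truncated sum is at most 4^k c above its mean.\<close>
  have bound: "(\<Sum>i\<in>I k. X i x) \<le> 4 ^ k * (expectation Y + c)"
    if "x \<in> space M - (large k \<union> dev k)" for x k
  proof -
    have "(\<Sum>i\<in>I k. X i x) = W k x"
      unfolding W_def using that by (intro sum.cong refl) (auto simp: large_def g_def min_def)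
    also have "W k x \<le> expectation (W k) + 4 ^ k * c" using that by (auto simp: dev_def)
    also have "expectation (W k) = (\<Sum>i\<in>I k. expectation (\<lambda>x. g k (X i x)))"
    proof -
      have "integrable M (\<lambda>x. g k (X i x))" if "i \<in> I k" for i
        using that I(2)[of k] g nonneg(1) by (intro integrable_const_bound[of _ "4 ^ k"]) auto
      then show ?thesis unfolding W_def by (rule Bochner_Integration.integral_sum)
    qed
    also have "\<dots> = (\<Sum>i\<in>I k. expectation (\<lambda>x. g k (Y x)))"
      using I(2)[of k] by (intro sum.cong refl transfer) auto
    also have "\<dots> \<le> (\<Sum>i\<in>I k. expectation Y)"
    proof (intro sum_mono Bochner_Integration.integral_mono int)
      show "integrable M (\<lambda>x. g k (Y x))"
        using g nonneg(2) by (intro integrable_const_bound[of _ "4 ^ k"]) auto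
    qed (use g nonneg in auto)
    also have "\<dots> = card (I k) * expectation Y" by simp
    also have "\<dots> \<le> 4 ^ k * expectation Y"
      using card_le nonneg by (intro mult_right_mono Bochner_Integration.integral_nonneg) auto
    finally show ?thesis by (simp add: algebra_simps)
  qed
  from AE show ?thesis
  proof eventually_elim
    case (elim x)
    then show ?case by eventually_elim (rule bound)
  qed
qed

lemma ex_power_of_two_between:
  assumes "n \<ge> 1"
  shows "\<exists>k. n \<le> 2 ^ k \<and> 2 ^ k \<le> 2 * (n::nat)"
  using assms
proof (induction n rule: nat_induct_at_least)
  case base
  show ?case by (rule exI[of _ 0]) simp
next
  case (Suc n)
  then obtain k where k: "n \<le> 2 ^ k" "2 ^ k \<le> 2 * n" by blast
  show ?case
  proof (cases "Suc n \<le> 2 ^ k")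
    case True
    with k show ?thesis by (intro exI[of _ k]) auto
  next
    case False
    with k Suc.hyps show ?thesis by (intro exI[of _ "Suc k"]) auto
  qed
qed

text \<open>Each unordered pair off the diagonal occurs twice; counting the diagonal twice too only
  increases a sum of nonnegative terms.\<close>

lemma symmetric_double_sum_le:
  fixes x :: "nat \<times> nat \<Rightarrow> real"
  assumes nonneg: "\<And>p. x p \<ge> 0" and "n \<le> m"
  shows "(\<Sum>i<n. \<Sum>j<n. x (min i j, max i j)) \<le> 2 * (\<Sum>p\<in>{(i, j). i \<le> j \<and> j < m}. x p)"
proof -
  let ?h = "\<lambda>i j. if i \<le> j then x (i, j) else 0"
  have "(\<Sum>i<n. \<Sum>j<n. x (min i j, max i j)) \<le> (\<Sum>i<n. \<Sum>j<n. ?h i j + ?h j i)"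
    using nonneg by (intro sum_mono) (auto simp: min_def max_def)
  also have "\<dots> = (\<Sum>i<n. \<Sum>j<n. ?h i j) + (\<Sum>i<n. \<Sum>j<n. ?h j i)"
    by (simp add: sum.distrib)
  also have "(\<Sum>i<n. \<Sum>j<n. ?h j i) = (\<Sum>i<n. \<Sum>j<n. ?h i j)" by (rule sum.swap)
  also have "(\<Sum>i<n. \<Sum>j<n. ?h i j) = (\<Sum>p\<in>{..<n} \<times> {..<n}. ?h (fst p) (snd p))"
    by (simp add: sum.cartesian_product split_def)
  also have "\<dots> = (\<Sum>p\<in>{p \<in> {..<n} \<times> {..<n}. fst p \<le> snd p}. x p)"
    by (subst sum.inter_filter) (auto intro!: sum.cong)
  also have "\<dots> \<le> (\<Sum>p\<in>{(i, j). i \<le> j \<and> j < m}. x p)"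
  proof (rule sum_mono2)
    show "finite {(i, j). i \<le> j \<and> j < m}"
      by (rule finite_subset[of _ "{..<m} \<times> {..<m}"]) auto
  qed (use nonneg \<open>n \<le> m\<close> in auto)
  finally show ?thesis by simp
qed

text \<open>Each n lies below some 2^k <= 2 n. The constant 8 is 2 from folding the square onto its
  upper triangle times 4 from 4^k <= (2 n)^2.\<close>

lemma (in prob_space) symmetric_double_sum_eventually_le:
  fixes X :: "nat \<times> nat \<Rightarrow> 'a \<Rightarrow> real"
  assumes indep: "indep_vars (\<lambda>_. borel) X upper_indices"
    and rv: "random_variable borel Y"
    and distr: "\<And>p. p \<in> upper_indices \<Longrightarrow> distr M borel (X p) = distr M borel Y"
    and nonneg: "\<And>p x. X p x \<ge> 0" "\<And>x. Y x \<ge> 0"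
    and int: "integrable M Y" and "c > 0"
  shows "AE x in M. \<forall>\<^sub>F n in sequentially.
           (\<Sum>i<n. \<Sum>j<n. X (min i j, max i j) x) \<le> 8 * (real n)\<^sup>2 * (expectation Y + c)"
proof -
  define I where "I k = {(i, j). i \<le> j \<and> j < (2::nat) ^ k}" for k
  have sub: "I k \<subseteq> {..<2 ^ k} \<times> {..<2 ^ k}" for k by (auto simp: I_def)
  have pow: "4 ^ k = (2 ^ k * 2 ^ k :: 'b :: comm_semiring_1)" for k
    by (simp add: power_mult_distrib[symmetric])
  have I: "finite (I k)" "I k \<subseteq> upper_indices" "card (I k) \<le> 4 ^ k" for k
    using finite_subset[OF sub[of k]] card_mono[OF _ sub[of k]] by (auto simp: I_def card_cartesian_product pow)
  have "AE x in M. \<forall>\<^sub>F k in sequentially. (\<Sum>p\<in>I k. X p x) \<le> 4 ^ k * (expectation Y + c)"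
    by (rule dyadic_sums_eventually_le[OF indep rv distr nonneg int I \<open>c > 0\<close>])
  then show ?thesis
  proof eventually_elim
    case (elim x)
    then obtain K where K: "\<And>k. k \<ge> K \<Longrightarrow> (\<Sum>p\<in>I k. X p x) \<le> 4 ^ k * (expectation Y + c)"
      by (auto simp: eventually_sequentially)
    have "(\<Sum>i<n. \<Sum>j<n. X (min i j, max i j) x) \<le> 8 * (real n)\<^sup>2 * (expectation Y + c)" if n: "n \<ge> 2 ^ K" for n
    proof -
      have "(1::nat) \<le> 2 ^ K" by simp
      then have "n \<ge> 1" using n by linarith
      then obtain k where k: "n \<le> 2 ^ k" "2 ^ k \<le> 2 * n" using ex_power_of_two_between by blast
      then have "(2::nat) ^ K \<le> 2 ^ k" using n by linarith
      then have "K \<le> k" by simp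
      have "(\<Sum>i<n. \<Sum>j<n. X (min i j, max i j) x) \<le> 2 * (\<Sum>p\<in>I k. X p x)"
        unfolding I_def by (rule symmetric_double_sum_le[of "\<lambda>p. X p x"]) (use nonneg k in auto)
      also have "\<dots> \<le> 2 * (4 ^ k * (expectation Y + c))" using K[OF \<open>K \<le> k\<close>] by simp
      also have "\<dots> \<le> 2 * ((2 * real n) * (2 * real n) * (expectation Y + c))"
      proof -
        have "(2::real) ^ k \<le> 2 * real n" using k(2) of_nat_mono[OF k(2), where 'a = real] by simp
        then have "(4::real) ^ k \<le> (2 * real n) * (2 * real n)" unfolding pow by (intro mult_mono) auto
        moreover have "expectation Y + c \<ge> 0"
          using nonneg(2) \<open>c > 0\<close> by (intro add_nonneg_nonneg Bochner_Integration.integral_nonneg) auto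
        ultimately show ?thesis by (intro mult_left_mono mult_right_mono) auto
      qed
      finally show ?thesis by (simp add: power2_eq_square)
    qed
    then show ?case by (auto simp: eventually_sequentially)
  qed
qed

section \<open>Uniform concentration of truncated row averages\<close>

text \<open>Hoeffding's inequality within a row gives deviation probability at most 2 q^n with q <
  1. Different rows share entries, but the union bound over n rows is still summable.\<close>

lemma (in prob_space) row_averages_eventually_close:
  fixes X :: "nat \<times> nat \<Rightarrow> 'a \<Rightarrow> real"
  assumes indep: "indep_vars (\<lambda>_. borel) X upper_indices"
    and rv: "random_variable borel Y"
    and distr: "\<And>p. p \<in> upper_indices \<Longrightarrow> distr M borel (X p) = distr M borel Y"
    and bounded: "AE x in M. Y x \<in> {0..T}" and "T > 0" "\<epsilon> > 0"
  shows "AE x in M. \<forall>\<^sub>F n in sequentially.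
           \<forall>i<n. \<bar>(\<Sum>j<n. X (min i j, max i j) x) / n - expectation Y\<bar> < \<epsilon>"
proof -
  define I where "I n i = (\<lambda>j. (min i j, max i j)) ` {..<n}" for n i :: nat
  \<comment> \<open>For fixed \<open>i\<close>, distinct columns give distinct unordered pairs,
    hence distinct and therefore independent table entries.\<close>
  have inj: "inj_on (\<lambda>j. (min i j, max i j)) A" for i :: nat and A
    by (auto simp: inj_on_def min_def max_def split: if_splits)
  have I_sub: "I n i \<subseteq> upper_indices" for n i by (auto simp: I_def)
  have card_I: "card (I n i) = n" for n i unfolding I_def by (subst card_image[OF inj]) simp
  have sum_I: "(\<Sum>p\<in>I n i. X p x) = (\<Sum>j<n. X (min i j, max i j) x)" for n i x
    unfolding I_def by (subst sum.reindex[OF inj]) simp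
  define bad where
    "bad n i = {x \<in> space M. \<bar>(\<Sum>p\<in>I n i. X p x) / n - expectation Y\<bar> \<ge> \<epsilon>}" for n i
  have [measurable]: "bad n i \<in> events" for n i
  proof -
    have "random_variable borel (\<lambda>x. \<Sum>p\<in>I n i. X p x)"
      using indep I_sub[of n i] by (intro borel_measurable_sum) (auto simp: indep_vars_def)
    note this[measurable]
    show ?thesis unfolding bad_def by measurable
  qed
  define q where "q = exp (- (2 * \<epsilon>\<^sup>2 / T\<^sup>2))"
  have q: "0 < q" "q < 1" using \<open>T > 0\<close> \<open>\<epsilon> > 0\<close> by (auto simp: q_def)
  have prob_bad: "prob (bad n i) \<le> 2 * q ^ n" if "n > 0" for n i
  proof -
    interpret H: Hoeffding_ineq_iid M "I n i" X Y 0 T "expectation Y"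
      using indep_vars_subset[OF indep I_sub[of n i]] distr I_sub[of n i] rv bounded
      by unfold_locales (auto simp: I_def)
    have "I n i \<noteq> {}" using that by (auto simp: I_def)
    then have "prob (bad n i) \<le> 2 * exp (- 2 * real n * \<epsilon>\<^sup>2 / (T - 0)\<^sup>2)"
      using H.Hoeffding_ineq_abs_ge'[of \<epsilon>] \<open>T > 0\<close> \<open>\<epsilon> > 0\<close> by (simp add: bad_def card_I)
    also have "exp (- 2 * real n * \<epsilon>\<^sup>2 / (T - 0)\<^sup>2) = q ^ n"
      by (simp add: q_def exp_of_nat_mult[symmetric] mult_ac)
    finally show ?thesis .
  qed
  have prob_Un: "prob (\<Union>i<n. bad n i) \<le> 2 * (real (Suc n) * q ^ n)" for n
  proof (cases "n = 0")
    case False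
    have "prob (\<Union>i<n. bad n i) \<le> (\<Sum>i<n. prob (bad n i))"
      by (intro finite_measure_subadditive_finite) auto
    also have "\<dots> \<le> (\<Sum>i<n. 2 * q ^ n)" using False by (intro sum_mono prob_bad) auto
    also have "\<dots> \<le> 2 * (real (Suc n) * q ^ n)" using q by (simp add: algebra_simps)
    finally show ?thesis .
  qed simp
  have "AE x in M. \<forall>\<^sub>F n in sequentially. x \<in> space M - (\<Union>i<n. bad n i)"
  proof (rule borel_cantelli_AE1)
    show "summable (\<lambda>n. prob (\<Union>i<n. bad n i))"
    proof (rule summable_comparison_test')
      \<comment> \<open>The factor \<open>Suc n\<close> instead of n makes this the derivative of
        the geometric series.\<close>
      show "summable (\<lambda>n. 2 * (real (Suc n) * q ^ n))"
        using q by (intro summable_mult sums_summable[OF geometric_deriv_sums]) auto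
    qed (use prob_Un in auto)
  qed (auto simp: less_top[symmetric])
  then show ?thesis
  proof eventually_elim
    case (elim x)
    then show ?case
      by eventually_elim (auto simp: bad_def sum_I not_le)
  qed
qed

section \<open>Counting the exceptional rows\<close>

text \<open>A deterministic count: a bad row carries at least \<delta> n / 3 above the truncation
  level, while the total excess is a small multiple of n^2. Levels and tolerances are indexed by
  natural numbers so that only countably many almost sure events are involved.\<close>

lemma exceptional_rows_negligible:
  fixes u :: "nat \<Rightarrow> nat \<Rightarrow> real" and m :: "nat \<Rightarrow> real"
  assumes close: "\<And>T N. \<forall>\<^sub>F n in sequentially.
        \<forall>i<n. \<bar>(\<Sum>j<n. min (u i j) (real (Suc T))) / n - m T\<bar> < inverse (real (Suc N))"
    and rest: "\<And>T. \<forall>\<^sub>F n in sequentially.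
        (\<Sum>i<n. \<Sum>j<n. u i j - min (u i j) (real (Suc T))) \<le> 8 * (real n)\<^sup>2 * (1 - m T + inverse (real (Suc T)))"
    and m: "m \<longlonglongrightarrow> 1" and "\<delta> > 0"
  shows "(\<lambda>n. real (card {i. i < n \<and> \<bar>row_sum u n i / n - 1\<bar> > \<delta>}) / n) \<longlonglongrightarrow> 0"
proof (rule order_tendstoI)
  fix a :: real assume "a < 0"
  then show "\<forall>\<^sub>F n in sequentially. a < real (card {i. i < n \<and> \<bar>row_sum u n i / n - 1\<bar> > \<delta>}) / n"
    by (intro always_eventually allI) (auto intro: less_le_trans)
next
  fix e :: real assume "0 < e"
  have "\<delta> / 3 > 0" using \<open>\<delta> > 0\<close> by simp
  \<comment> \<open>24 is the constant 8 in the bound on the total excess times 3 from \<delta> /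
    3.\<close>
  have "(\<lambda>T. 24 / \<delta> * (1 - m T + inverse (real (Suc T)))) \<longlonglongrightarrow> 24 / \<delta> * (1 - 1 + 0)"
    by (intro tendsto_intros m LIMSEQ_inverse_real_of_nat)
  then have "\<forall>\<^sub>F T in sequentially. 24 / \<delta> * (1 - m T + inverse (real (Suc T))) < e"
    using \<open>0 < e\<close> by (intro order_tendstoD(2)) auto
  moreover have "\<forall>\<^sub>F T in sequentially. dist (m T) 1 < \<delta> / 3"
    using m \<open>\<delta> / 3 > 0\<close> by (rule tendstoD)
  ultimately have "\<exists>T. 24 / \<delta> * (1 - m T + inverse (real (Suc T))) < e \<and> dist (m T) 1 < \<delta> / 3"
    using eventually_conj eventually_happens'[OF sequentially_bot] by blast
  then obtain T where T: "24 / \<delta> * (1 - m T + inverse (real (Suc T))) < e" "\<bar>m T - 1\<bar> < \<delta> / 3"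
    by (auto simp: dist_real_def)
  obtain N where N: "inverse (real (Suc N)) < \<delta> / 3" using reals_Archimedean[OF \<open>\<delta> / 3 > 0\<close>] by blast
  show "\<forall>\<^sub>F n in sequentially. real (card {i. i < n \<and> \<bar>row_sum u n i / n - 1\<bar> > \<delta>}) / n < e"
    using close[of T N] rest[of T] eventually_gt_at_top[of 0]
  proof eventually_elim
    case (elim n)
    define R where "R i = (\<Sum>j<n. u i j - min (u i j) (real (Suc T)))" for i
    define s where "s = 1 - m T + inverse (real (Suc T))"
    define bad where "bad = {i. i < n \<and> \<bar>row_sum u n i / n - 1\<bar> > \<delta>}"
    have R_nonneg: "R i \<ge> 0" for i unfolding R_def by (intro sum_nonneg) auto
    \<comment> \<open>The truncated average is within 2 \<delta> / 3 of 1 and the excess is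
      nonnegative, so a deviation beyond \<delta> must be upward and is paid for by the
      excess.\<close>
    have R_bad: "R i \<ge> \<delta> / 3 * n" if "i \<in> bad" for i
    proof -
      have i: "i < n" "\<bar>row_sum u n i / n - 1\<bar> > \<delta>" using that by (auto simp: bad_def)
      have split: "row_sum u n i / n = (\<Sum>j<n. min (u i j) (real (Suc T))) / n + R i / n"
        by (simp add: row_sum_def R_def sum_subtractf add_divide_distrib[symmetric])
      have close_i: "\<bar>(\<Sum>j<n. min (u i j) (real (Suc T))) / n - m T\<bar> < inverse (real (Suc N))"
        using elim(1) i(1) by blast
      have "R i / n \<ge> 0" using R_nonneg by simp
      then have "R i / n \<ge> \<delta> / 3" using i(2) close_i N T(2) unfolding split by linarith
      then show ?thesis using \<open>0 < n\<close> by (simp add: field_simps)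
    qed
    have "card bad * (\<delta> / 3 * n) = (\<Sum>i\<in>bad. \<delta> / 3 * n)" by simp
    also have "\<dots> \<le> (\<Sum>i\<in>bad. R i)" by (intro sum_mono R_bad)
    also have "\<dots> \<le> (\<Sum>i<n. R i)" using R_nonneg by (intro sum_mono2) (auto simp: bad_def)
    also have "\<dots> \<le> 8 * (real n)\<^sup>2 * s"
      using elim(2) by (simp only: R_def s_def)
    finally have "(card bad * \<delta>) * n \<le> (24 * s * n) * n"
      by (simp add: power2_eq_square algebra_simps)
    then have "card bad * \<delta> \<le> 24 * s * n" using \<open>0 < n\<close> by simp
    then have "real (card bad) / n \<le> 24 / \<delta> * s"
      using \<open>0 < n\<close> \<open>\<delta> > 0\<close> by (simp add: field_simps)
    with T(1) show ?case by (simp add: bad_def s_def)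
  qed
qed

section \<open>The reversible Markov matrix\<close>

lemma heavy_tailed_AE_nonneg:
  assumes "L \<in> heavy_tailed \<alpha>" shows "AE x in L. x \<ge> 0"
proof -
  have L: "prob_space L" "sets L = sets borel" "measure L {..<0} = 0"
    using assms by (auto simp: heavy_tailed_def)
  interpret prob_space L by fact
  have "AE x in L. x \<notin> {..<0}"
    using L by (intro AE_not_in) (auto simp: null_sets_def emeasure_eq_measure)
  then show ?thesis by eventually_elim auto
qed

text \<open>Identifies the scale in the definition of \<mu>, taken from the law of the absolute
  value, with the scale of \<open>L\<close>.\<close>

lemma heavy_tailed_distr_abs:
  assumes "L \<in> heavy_tailed \<alpha>" shows "distr L borel abs = L"
proof -
  have sets: "sets L = sets borel" using assms by (auto simp: heavy_tailed_def)
  have "distr L borel abs = distr L borel (\<lambda>x. x)"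
    using heavy_tailed_AE_nonneg[OF assms]
    by (intro distr_cong_AE) (auto simp: measurable_cong_sets[OF sets refl])
  also have "\<dots> = L" using sets by (intro distr_id2) simp
  finally show ?thesis .
qed

text \<open>Slow variation at x = 1 is the reason: where l t = 0 the quotient l t / l t is 0 by
  convention, which convergence to 1 excludes for large \<open>t\<close>.\<close>

lemma heavy_tailed_tail_pos:
  assumes "L \<in> heavy_tailed \<alpha>" shows "\<forall>\<^sub>F t in at_top. tail L t \<noteq> 0"
proof -
  obtain l where l: "slowly_varying l" "\<And>t. t > 0 \<Longrightarrow> tail L t = l t * t powr (- \<alpha>)"
    using assms by (auto simp: heavy_tailed_def)
  have "((\<lambda>t. l (1 * t) / l t) \<longlongrightarrow> 1) at_top" using l(1)[unfolded slowly_varying_def, rule_format, of 1] by simp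
  then have "\<forall>\<^sub>F t in at_top. l (1 * t) / l t > 0" by (rule order_tendstoD) simp
  then show ?thesis using eventually_gt_at_top[of 0] by eventually_elim (auto simp: l(2))
qed

lemma heavy_tailed_tail_balance:
  assumes "L \<in> heavy_tailed \<alpha>"
  shows "((\<lambda>t. measure L {t<..} / measure L {x. \<bar>x\<bar> > t}) \<longlongrightarrow> 1) at_top"
proof (rule tendsto_eventually)
  have sets: "sets L = sets borel" using assms by (auto simp: heavy_tailed_def)
  have eq: "measure L {x. \<bar>x\<bar> > t} = measure L {t<..}" if "t > 0" for t
    using heavy_tailed_AE_nonneg[OF assms] that sets
    by (intro measure_eq_AE) (auto elim!: eventually_mono simp: sets)
  show "\<forall>\<^sub>F t in at_top. measure L {t<..} / measure L {x. \<bar>x\<bar> > t} = 1"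
    using heavy_tailed_tail_pos[OF assms] eventually_gt_at_top[of 0]
    by eventually_elim (simp add: tail_def eq)
qed

theorem theorem1p3:
  fixes M :: "'a measure" and U :: "nat \<Rightarrow> nat \<Rightarrow> 'a \<Rightarrow> real"
    and L \<mu> :: "real measure" and \<alpha> :: real
  assumes "1 < \<alpha>" and "\<alpha> < 2"
    and "L \<in> heavy_tailed \<alpha>"
    and "integral\<^sup>L L (\<lambda>x. x) = 1"
    and "prob_space M"
    and "iid_symmetric_table M L U"
    and "limiting_spectral_distribution \<alpha> \<mu>"
  shows "AE \<omega> in M. converges_weakly
           (\<lambda>n. empirical_spectral_measure (kappa L n \<cdot>\<^sub>m markov_matrix (\<lambda>i j. U i j \<omega>) n)) \<mu>"
proof -
  interpret prob_space M by fact
  have L: "prob_space L" "sets L = sets borel" using assms(3) by (auto simp: heavy_tailed_def)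
  define X where "X = (\<lambda>(i, j). U i j)"
  have indep: "indep_vars (\<lambda>_. borel) X upper_indices"
    and distr: "\<And>p. p \<in> upper_indices \<Longrightarrow> distr M borel (X p) = L"
    and sym: "\<And>i j. U j i = U i j"
    using assms(6) by (auto simp: iid_symmetric_table_def X_def)
  have rv: "random_variable borel (X p)" if "p \<in> upper_indices" for p
    using indep that by (auto simp: indep_vars_def)
  have X: "X (min i j, max i j) = U i j" for i j by (simp add: X_def min_def max_def sym)
  define Y where "Y = X (0, 0)"
  have Y [measurable]: "random_variable borel Y" unfolding Y_def by (rule rv) simp
  have distr_Y: "distr M borel Y = L" unfolding Y_def by (rule distr) simp
  \<comment> \<open>A non-integrable function has integral 0 by convention, so mean 1 forces
    integrability.\<close>
  have "integrable L (\<lambda>x. x)" using assms(4) not_integrable_integral_eq by fastforce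
  then have int_Y: "integrable M Y"
    unfolding distr_Y[symmetric] by (subst (asm) integrable_distr_eq) auto
  have exp_Y: "expectation Y = 1"
    using assms(4) unfolding distr_Y[symmetric] by (subst (asm) integral_distr) auto
  have nonneg_X: "AE \<omega> in M. X p \<omega> \<ge> 0" if "p \<in> upper_indices" for p
  proof (rule AE_distrD[OF rv[OF that]])
    show "AE x in distr M borel (X p). x \<ge> 0"
      unfolding distr[OF that] by (rule heavy_tailed_AE_nonneg[OF assms(3)])
  qed
  have nonneg_Y: "AE \<omega> in M. Y \<omega> \<ge> 0" unfolding Y_def by (rule nonneg_X) simp
  have distr_comp: "distr M borel (\<lambda>\<omega>. h (X p \<omega>)) = distr M borel (\<lambda>\<omega>. h (Y \<omega>))"
    if "p \<in> upper_indices" "h \<in> borel_measurable borel" for p and h :: "real \<Rightarrow> real"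
    using distr_distr[OF that(2) rv[OF that(1)]] distr_distr[OF that(2) Y] distr[OF that(1)] distr_Y
    by (simp add: comp_def)
  define m where "m T = expectation (\<lambda>\<omega>. min (Y \<omega>) (real (Suc T)))" for T
  have int_min: "integrable M (\<lambda>\<omega>. min (Y \<omega>) (real (Suc T)))" for T
    using int_Y by (intro integrable_min) auto
  have "m \<longlonglongrightarrow> expectation Y"
    unfolding m_def
  proof (rule integral_dominated_convergence)
    show "integrable M (\<lambda>\<omega>. \<bar>Y \<omega>\<bar>)" using int_Y by auto
    show "AE \<omega> in M. (\<lambda>T. min (Y \<omega>) (real (Suc T))) \<longlonglongrightarrow> Y \<omega>"
    proof (rule AE_I2)
      fix \<omega>
      obtain K where "Y \<omega> < real K" using reals_Archimedean2 by blast
      then have "\<forall>\<^sub>F T in sequentially. min (Y \<omega>) (real (Suc T)) = Y \<omega>"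
        by (intro eventually_sequentiallyI[of K]) (auto simp: min_def)
      then show "(\<lambda>T. min (Y \<omega>) (real (Suc T))) \<longlonglongrightarrow> Y \<omega>" by (rule tendsto_eventually)
    qed
  qed auto
  then have m: "m \<longlonglongrightarrow> 1" by (simp add: exp_Y)
  have close: "AE \<omega> in M. \<forall>T N. \<forall>\<^sub>F n in sequentially.
      \<forall>i<n. \<bar>(\<Sum>j<n. min (U i j \<omega>) (real (Suc T))) / n - m T\<bar> < inverse (real (Suc N))"
  proof (unfold AE_all_countable, intro allI)
    fix T N
    have "AE \<omega> in M. \<forall>\<^sub>F n in sequentially. \<forall>i<n.
        \<bar>(\<Sum>j<n. min (X (min i j, max i j) \<omega>) (real (Suc T))) / n - m T\<bar> < inverse (real (Suc N))"
      unfolding m_def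
    proof (rule row_averages_eventually_close[where T = "real (Suc T)"])
      show "indep_vars (\<lambda>_. borel) (\<lambda>p \<omega>. min (X p \<omega>) (real (Suc T))) upper_indices"
        by (rule indep_vars_compose2[OF indep]) auto
      show "AE \<omega> in M. min (Y \<omega>) (real (Suc T)) \<in> {0..real (Suc T)}"
        using nonneg_Y by eventually_elim auto
    qed (auto intro!: distr_comp)
    then show "AE \<omega> in M. \<forall>\<^sub>F n in sequentially.
      \<forall>i<n. \<bar>(\<Sum>j<n. min (U i j \<omega>) (real (Suc T))) / n - m T\<bar> < inverse (real (Suc N))"
      by (simp only: X)
  qed
  \<comment> \<open>The part of a weight above \<open>Suc T\<close> is nonnegative everywhere, not
    just almost surely, and has mean 1 - m T; the slack in the double-sum bound is
    \<open>inverse (real (Suc T))\<close>.\<close>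
  have rest: "AE \<omega> in M. \<forall>T. \<forall>\<^sub>F n in sequentially.
      (\<Sum>i<n. \<Sum>j<n. U i j \<omega> - min (U i j \<omega>) (real (Suc T))) \<le> 8 * (real n)\<^sup>2 * (1 - m T + inverse (real (Suc T)))"
  proof (unfold AE_all_countable, intro allI)
    fix T
    have "expectation (\<lambda>\<omega>. Y \<omega> - min (Y \<omega>) (real (Suc T))) = 1 - m T"
      using int_Y int_min by (simp add: m_def exp_Y)
    moreover have "AE \<omega> in M. \<forall>\<^sub>F n in sequentially.
        (\<Sum>i<n. \<Sum>j<n. X (min i j, max i j) \<omega> - min (X (min i j, max i j) \<omega>) (real (Suc T)))
        \<le> 8 * (real n)\<^sup>2 * (expectation (\<lambda>\<omega>. Y \<omega> - min (Y \<omega>) (real (Suc T))) + inverse (real (Suc T)))"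
    proof (rule symmetric_double_sum_eventually_le)
      show "indep_vars (\<lambda>_. borel) (\<lambda>p \<omega>. X p \<omega> - min (X p \<omega>) (real (Suc T))) upper_indices"
        by (rule indep_vars_compose2[OF indep]) auto
      show "distr M borel (\<lambda>\<omega>. X p \<omega> - min (X p \<omega>) (real (Suc T)))
          = distr M borel (\<lambda>\<omega>. Y \<omega> - min (Y \<omega>) (real (Suc T)))" if "p \<in> upper_indices" for p
        using that by (rule distr_comp) measurable
    qed (use int_Y int_min in auto)
    ultimately show "AE \<omega> in M. \<forall>\<^sub>F n in sequentially.
        (\<Sum>i<n. \<Sum>j<n. U i j \<omega> - min (U i j \<omega>) (real (Suc T))) \<le> 8 * (real n)\<^sup>2 * (1 - m T + inverse (real (Suc T)))"
      by (simp only: X)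
  qed
  have nonneg: "AE \<omega> in M. \<forall>i j. U i j \<omega> \<ge> 0"
  proof (unfold AE_all_countable, intro allI)
    fix i j show "AE \<omega> in M. U i j \<omega> \<ge> 0"
      using nonneg_X[of "(min i j, max i j)"] by (simp add: X)
  qed
  have \<mu>: "real_distribution \<mu>"
    using assms(7) unfolding limiting_spectral_distribution_def
    by (simp add: real_distribution_def real_distribution_axioms_def)
  have "AE x in PiM upper_indices (\<lambda>_. L). converges_weakly
      (\<lambda>n. empirical_spectral_measure (inverse (quantile_scale L n) \<cdot>\<^sub>m symmetric_matrix x n)) \<mu>"
  proof -
    have "prob_space L \<and> sets L = sets borel \<and> distr L borel abs \<in> heavy_tailed \<alpha> \<and>
        (\<exists>\<theta>. ((\<lambda>t. measure L {t<..} / measure L {x. \<bar>x\<bar> > t}) \<longlongrightarrow> \<theta>) at_top)"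
      using L assms(3) heavy_tailed_tail_balance[OF assms(3)]
      by (auto simp: heavy_tailed_distr_abs[OF assms(3)])
    with assms(7)[unfolded limiting_spectral_distribution_def, THEN conjunct2, THEN conjunct2,
        THEN conjunct2, THEN spec, THEN mp, of L]
    show ?thesis by (simp only: heavy_tailed_distr_abs[OF assms(3)])
  qed
  \<comment> \<open>By independence the product measure is the joint law of the table, which moves
    the almost sure statement from the canonical space to \<open>M\<close>.\<close>
  also have "PiM upper_indices (\<lambda>_. L) = distr M (PiM upper_indices (\<lambda>_. borel)) (\<lambda>\<omega>. \<lambda>p\<in>upper_indices. X p \<omega>)"
  proof -
    have "upper_indices \<noteq> {}" by auto
    then have "distr M (PiM upper_indices (\<lambda>_. borel)) (\<lambda>\<omega>. \<lambda>p\<in>upper_indices. X p \<omega>)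
        = PiM upper_indices (\<lambda>p. distr M borel (X p))"
      using indep indep_vars_iff_distr_eq_PiM'[of upper_indices X "\<lambda>_. borel"] rv by blast
    also have "\<dots> = PiM upper_indices (\<lambda>_. L)" by (rule PiM_cong) (auto simp: distr)
    finally show ?thesis by simp
  qed
  finally have "AE \<omega> in M. converges_weakly (\<lambda>n. empirical_spectral_measure
      (inverse (quantile_scale L n) \<cdot>\<^sub>m symmetric_matrix (\<lambda>p\<in>upper_indices. X p \<omega>) n)) \<mu>"
    by (rule AE_distrD[rotated]) (intro measurable_restrict rv)
  moreover have "symmetric_matrix (\<lambda>p\<in>upper_indices. X p \<omega>) n = mat n n (\<lambda>(i, j). U i j \<omega>)" for n \<omega>
    by (rule eq_matI) (auto simp: symmetric_matrix_def X)
  ultimately have "AE \<omega> in M. converges_weakly (\<lambda>n. empirical_spectral_measure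
      (inverse (quantile_scale L n) \<cdot>\<^sub>m mat n n (\<lambda>(i, j). U i j \<omega>))) \<mu>" by simp
  \<comment> \<open>From here on the argument is deterministic, at a fixed sample point.\<close>
  then show ?thesis using close rest nonneg
  proof eventually_elim
    case (elim \<omega>)
    show ?case unfolding kappa_def
    proof (rule converges_weakly_markov_matrix[OF _ _ _ \<mu> elim(1)])
      fix \<delta> :: real assume "\<delta> > 0"
      then show "(\<lambda>n. real (card {i. i < n \<and> \<bar>row_sum (\<lambda>i j. U i j \<omega>) n i / n - 1\<bar> > \<delta>}) / n) \<longlonglongrightarrow> 0"
        using elim(2,3) m by (intro exceptional_rows_negligible) blast+
    qed (use sym elim(4) in auto)
  qed
qed

end
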